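(* Let $n\ge2$ and let $\mathcal{A}(t,x)=(A_0(t,x),\dots,A_n(t,x))$ be $C^\infty$ in $(t,x)\in\mathbb{R}\times\mathbb{R}^n$. Suppose that for any $M>0$, any non-negative integer $\alpha$ and any multi-index $\beta$ there exist constants $C_{M,\alpha,\beta}>0$ such that $$(1+|t|)^M|\partial_t^\alpha\partial_x^\beta A_j(t,x)|\le C_{M,\alpha,\beta},\qquad 0\le j\le n.$$ Suppose in addition that $A_j(t,x)=0$ for $|x|\ge R>0$, $0\le j\le n$, and that $$\int_{-\infty}^{\infty}\Big(A_0+\sum_{j=1}^n\omega_jA_j\Big)(t+s,x+s\omega)\,ds=0\qquad\text{for all }(t,x)\in\mathbb{R}\times\mathbb{R}^n,\ \omega\in S^{n-1}.$$ Then there exists $\varphi\in C^\infty(\mathbb{R}\times\mathbb{R}^n)$ such that (i) $A_0=\partial_t\varphi$ and $A_j=\partial_{x_j}\varphi$ for $1\le j\le n$; (ii) $\operatorname{supp}\varphi\subseteq\mathbb{R}\times\{|x|\le R\}$ and, for all $M>0$ and all $\alpha,\beta$, $(1+|t|)^M|\partial_t^\alpha\partial_x^\beta\varphi(t,x)|\le C'_{M,\alpha,\beta}$ for some constants $C'_{M,\alpha,\beta}$.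
   Context: Functions are complex-valued. $S^{n-1}$ is the unit sphere of $\mathbb{R}^n$. $R>0$ is a fixed number. *)

theory Defs
  imports "HOL-Analysis.Analysis"
begin

definition partial :: "'a::euclidean_space \<Rightarrow> ('a \<Rightarrow> 'b::real_normed_vector) \<Rightarrow> 'a \<Rightarrow> 'b" where
  "partial v f p = vector_derivative (\<lambda>h. f (p + h *\<^sub>R v)) (at 0)"

text \<open>Differentiability (in the Frechet sense) at every stage ensures that the
  derivatives given by \<^const>\<open>partial\<close> really exist.\<close>

fun Ck :: "nat \<Rightarrow> ('a::euclidean_space \<Rightarrow> 'b::real_normed_vector) \<Rightarrow> bool" where
  "Ck 0 f \<longleftrightarrow> continuous_on UNIV f"
| "Ck (Suc k) f \<longleftrightarrow> (\<forall>p. f differentiable (at p)) \<and> (\<forall>b\<in>Basis. Ck k (partial b f))"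

definition smooth :: "('a::euclidean_space \<Rightarrow> 'b::real_normed_vector) \<Rightarrow> bool" where
  "smooth f \<longleftrightarrow> (\<forall>k. Ck k f)"

abbreviation partial_t :: "(real \<times> (real^'n) \<Rightarrow> complex) \<Rightarrow> real \<times> (real^'n) \<Rightarrow> complex" where
  "partial_t \<equiv> partial (1, 0)"

abbreviation partial_x :: "'n \<Rightarrow> (real \<times> (real^'n) \<Rightarrow> complex) \<Rightarrow> real \<times> (real^'n) \<Rightarrow> complex" where
  "partial_x j \<equiv> partial (0, axis j 1)"

text \<open>The index type carries no canonical order, so the order in which the operators
  \<open>partial_x j\<close> are composed is fixed by a choice; it is immaterial for smooth functions.\<close>

definition index_list :: "'n::finite list" where
  "index_list = (SOME js. distinct js \<and> set js = UNIV)"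

lemma index_list: "distinct (index_list :: 'n::finite list)" "set (index_list :: 'n list) = UNIV"
proof -
  have "\<exists>js :: 'n list. distinct js \<and> set js = UNIV"
    using finite_distinct_list[of "UNIV :: 'n set"] by auto
  then have "distinct (index_list :: 'n list) \<and> set (index_list :: 'n list) = UNIV"
    unfolding index_list_def by (rule someI_ex)
  then show "distinct (index_list :: 'n list)" "set (index_list :: 'n list) = UNIV"
    by auto
qed

definition multi_partial ::
  "nat \<Rightarrow> ('n \<Rightarrow> nat) \<Rightarrow> (real \<times> (real^'n) \<Rightarrow> complex) \<Rightarrow> real \<times> (real^'n) \<Rightarrow> complex" where
  "multi_partial \<alpha> \<beta> f = (partial_t ^^ \<alpha>) (foldr (\<lambda>j. partial_x j ^^ \<beta> j) index_list f)"

end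

theory Submission
  imports Defs "HOL-Complex_Analysis.Complex_Analysis" "HOL-Probability.Sinc_Integral"
begin

text \<open>
  Write \<open>f_hat\<close> for the Fourier transform of a function on space-time, with phase
  \<open>exp (\<i> \<eta> \<bullet> x - \<i> \<tau> t)\<close>. Integrating the light ray hypothesis over all lines with direction
  \<open>(1, \<omega>)\<close> against this phase, which is constant on these lines exactly when \<open>\<eta> \<bullet> \<omega> = \<tau>\<close>,
  gives \<open>A0_hat + \<Sum> \<omega>\<^sub>j A\<^sub>j_hat = 0\<close> at \<open>(\<tau>, \<eta>)\<close> for every unit vector \<open>\<omega>\<close> with
  \<open>\<eta> \<bullet> \<omega> = \<tau>\<close>. For a space-like frequency, that is for \<open>\<bar>\<tau>\<bar> < \<bar>\<eta>\<bar>\<close>, the affine span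
  of these \<open>\<omega>\<close> is the hyperplane \<open>\<eta> \<bullet> \<omega> = \<tau>\<close> because the dimension is at least two, so the
  covector \<open>(A0_hat, A_hat)\<close> is a multiple of \<open>(- \<tau>, \<eta>)\<close> (\<open>spacelike_covector_proportional\<close>). This says that
  the transform of the curl component \<open>\<partial>\<^sub>t A\<^sub>j - \<partial>\<^sub>j A0\<close> vanishes at space-like frequencies.

  The potential has compact support in space, so for fixed \<open>\<tau>\<close> its transform extends to an
  entire function on every complex line \<open>{\<zeta> \<theta>}\<close>, with real \<open>\<theta> \<noteq> 0\<close>, of spatial frequencies (\<open>fourier_laplace_entire\<close>).
  The space-like frequencies contain a ray of each such line, so the transform of the curl
  component vanishes on the whole line. It is evaluated at \<open>\<eta> = - \<i> \<theta>\<close>: the integral of the curl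
  component against \<open>exp (\<theta> \<bullet> x - \<i> \<tau> t)\<close> is zero for all real \<open>\<tau>\<close> and \<open>\<theta>\<close>. Real
  exponents in space are convenient because these functions generate an algebra to which the
  Stone--Weierstrass theorem applies, and this forces the curl component to vanish
  (\<open>fourier_laplace_injective\<close>).

  The equations \<open>\<partial>\<^sub>t A\<^sub>j = \<partial>\<^sub>j A0\<close> suffice to show that
  \<open>\<phi> (t, x) = \<integral>\<^bsub>-\<infinity>\<^esub>\<^bsup>t\<^esup> A0 (s, x) ds\<close> has spatial gradient \<open>A\<close>. As \<open>t \<rightarrow> \<infinity>\<close> this
  gradient tends to zero, so the limit of \<open>\<phi>\<close> does not depend on \<open>x\<close>; it is zero outside the
  ball and hence everywhere. Therefore \<open>\<phi>\<close> is also minus the integral of \<open>A0\<close> over the future,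
  and it decays rapidly in both time directions. Every proper derivative of \<open>\<phi>\<close> is a
  derivative of a component of the given potential.
\<close>

section \<open>Partial derivatives and multi-indices\<close>

lemma has_vector_derivative_along_line:
  assumes "(f has_derivative f') (at (p + t *\<^sub>R v))"
  shows "((\<lambda>t. f (p + t *\<^sub>R v)) has_vector_derivative f' v) (at t)"
proof -
  have "((\<lambda>t. p + t *\<^sub>R v) has_derivative (\<lambda>h. h *\<^sub>R v)) (at t)"
    by (auto intro!: derivative_eq_intros)
  then have "((\<lambda>t. f (p + t *\<^sub>R v)) has_derivative (\<lambda>h. f' (h *\<^sub>R v))) (at t)"
    using assms by (rule has_derivative_compose)
  then show ?thesis
    using has_derivative_bounded_linear[OF assms]
    by (simp add: has_vector_derivative_def bounded_linear.linear linear_cmul)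
qed

lemma partial_eq:
  assumes "(f has_derivative f') (at p)"
  shows "partial v f p = f' v"
  unfolding partial_def
  using has_vector_derivative_along_line[of f f' p 0 v] assms by (simp add: vector_derivative_at)

lemma Basis_prod_components: "(1, 0) \<in> (Basis :: (real \<times> (real^'n)) set)" "(0, axis j 1) \<in> (Basis :: (real \<times> (real^'n)) set)"
  by (auto simp: Basis_prod_def Basis_vec_def)

lemma smooth_continuous: "smooth f \<Longrightarrow> continuous_on UNIV f"
  unfolding smooth_def by (metis Ck.simps(1))

lemma smooth_differentiable: "smooth f \<Longrightarrow> f differentiable (at p)"
  unfolding smooth_def by (metis Ck.simps(2))

lemma smooth_partial: "smooth f \<Longrightarrow> b \<in> Basis \<Longrightarrow> smooth (partial b f)"
  unfolding smooth_def by (metis Ck.simps(2))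

lemma smooth_has_derivative:
  fixes f :: "real \<times> (real^'n) \<Rightarrow> complex"
  assumes "smooth f"
  shows "(f has_derivative (\<lambda>(h, v). h *\<^sub>R partial_t f p + (\<Sum>j\<in>UNIV. (v $ j) *\<^sub>R partial_x j f p))) (at p)"
proof -
  obtain f' where f': "(f has_derivative f') (at p)"
    using smooth_differentiable[OF assms] unfolding differentiable_def by blast
  have lin: "linear f'" using f' by (rule has_derivative_linear)
  have "f' (h, v) = h *\<^sub>R partial_t f p + (\<Sum>j\<in>UNIV. (v $ j) *\<^sub>R partial_x j f p)" for h v
  proof -
    have "(h, v) = h *\<^sub>R (1, 0) + (\<Sum>j\<in>UNIV. (v $ j) *\<^sub>R (0, axis j 1))"
      using basis_expansion[of v]
      by (simp add: prod_eq_iff fst_sum snd_sum scalar_mult_eq_scaleR)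
    also have "f' \<dots> = h *\<^sub>R f' (1, 0) + (\<Sum>j\<in>UNIV. (v $ j) *\<^sub>R f' (0, axis j 1))"
      by (simp only: linear_add[OF lin] linear_scale[OF lin] linear_sum[OF lin] o_def)
    finally show ?thesis by (simp only: partial_eq[OF f'])
  qed
  then have "f' = (\<lambda>(h, v). h *\<^sub>R partial_t f p + (\<Sum>j\<in>UNIV. (v $ j) *\<^sub>R partial_x j f p))"
    by auto
  then show ?thesis using f' by simp
qed

lemma smooth_line_derivative:
  fixes f :: "real \<times> (real^'n) \<Rightarrow> complex"
  assumes "smooth f"
  shows "((\<lambda>t. f (t, y + t *\<^sub>R w)) has_vector_derivative
     partial_t f (t, y + t *\<^sub>R w) + (\<Sum>j\<in>UNIV. (w $ j) *\<^sub>R partial_x j f (t, y + t *\<^sub>R w))) (at t)"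
  using has_vector_derivative_along_line[where p = "(0, y)" and t = t and v = "(1, w)", OF smooth_has_derivative[OF assms]]
  by simp

lemma foldr_funpow_zero: "(\<And>j. j \<in> set js \<Longrightarrow> \<beta> j = 0) \<Longrightarrow> foldr (\<lambda>j. g j ^^ \<beta> j) js f = f"
  by (induction js) auto

text \<open>The operator that is peeled off is the innermost one that occurs, so no operators have to be
  exchanged. This is what later reduces derivatives of the primitive to derivatives of its
  gradient without any appeal to the symmetry of mixed derivatives.\<close>

lemma foldr_funpow_decrease:
  assumes "distinct js" "\<exists>j\<in>set js. \<beta> j \<noteq> 0"
  shows "\<exists>j\<in>set js. \<beta> j \<noteq> 0 \<and>
    foldr (\<lambda>j. g j ^^ \<beta> j) js f = foldr (\<lambda>i. g i ^^ (\<beta>(j := \<beta> j - 1)) i) js (g j f)"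
  using assms
proof (induction js)
  case (Cons a js)
  show ?case
  proof (cases "\<exists>j\<in>set js. \<beta> j \<noteq> 0")
    case True
    then obtain j where j: "j \<in> set js" "\<beta> j \<noteq> 0"
      "foldr (\<lambda>j. g j ^^ \<beta> j) js f = foldr (\<lambda>i. g i ^^ (\<beta>(j := \<beta> j - 1)) i) js (g j f)"
      using Cons by auto
    moreover have "a \<noteq> j" using j Cons.prems by auto
    ultimately show ?thesis by (intro bexI[of _ j]) auto
  next
    case False
    then have "\<beta> a \<noteq> 0" using Cons.prems by auto
    then obtain m where m: "\<beta> a = Suc m" by (cases "\<beta> a") auto
    have "foldr (\<lambda>j. g j ^^ \<beta> j) js f = f"
      using False by (intro foldr_funpow_zero) auto
    moreover have "foldr (\<lambda>i. g i ^^ (\<beta>(a := m)) i) js (g a f) = g a f"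
      using False Cons.prems by (intro foldr_funpow_zero) auto
    ultimately show ?thesis
      using m by (intro bexI[of _ a]) (auto simp: funpow_swap1)
  qed
qed simp

lemma multi_partial_decrease_space:
  assumes "\<beta> \<noteq> (\<lambda>_. 0)"
  shows "\<exists>j. \<beta> j \<noteq> 0 \<and> multi_partial \<alpha> \<beta> f = multi_partial \<alpha> (\<beta>(j := \<beta> j - 1)) (partial_x j f)"
proof -
  have "\<exists>j\<in>set index_list. \<beta> j \<noteq> 0"
    using assms by (auto simp: index_list fun_eq_iff)
  from foldr_funpow_decrease[OF index_list(1) this, of partial_x f] obtain j where
    "\<beta> j \<noteq> 0" and eq: "foldr (\<lambda>j. partial_x j ^^ \<beta> j) index_list f =
      foldr (\<lambda>i. partial_x i ^^ (\<beta>(j := \<beta> j - 1)) i) index_list (partial_x j f)"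
    by blast
  then show ?thesis
    unfolding multi_partial_def eq by blast
qed

lemma multi_partial_no_space: "multi_partial \<alpha> (\<lambda>_. 0) f = (partial_t ^^ \<alpha>) f"
  by (simp add: multi_partial_def foldr_funpow_zero[where \<beta> = "\<lambda>_. 0", simplified])

lemma multi_partial_single: "multi_partial 0 ((\<lambda>_. 0)(j := 1)) f = partial_x j f"
proof -
  have "((\<lambda>_. 0)(j := 1)) \<noteq> (\<lambda>_. 0 :: nat)" by (auto simp: fun_eq_iff)
  from multi_partial_decrease_space[OF this, of 0 f] obtain i 
    where i: "((\<lambda>_. 0)(j := 1)) i \<noteq> (0 :: nat)"
     "multi_partial 0 ((\<lambda>_. 0)(j := 1)) f =
       multi_partial 0 (((\<lambda>_. 0)(j := 1))(i := ((\<lambda>_. 0)(j := 1)) i - 1)) (partial_x i f)" by blast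
  have "i = j" using i(1) by (auto split: if_splits)
  then have "((\<lambda>_. 0)(j := 1))(i := ((\<lambda>_. 0)(j := 1)) i - 1) = (\<lambda>_. 0 :: nat)" by auto
  with i(2) \<open>i = j\<close> show ?thesis by (simp add: multi_partial_no_space)
qed

lemma partial_zero_outside:
  fixes f :: "real \<times> (real^'n) \<Rightarrow> complex"
  assumes "\<And>t x. norm x > R \<Longrightarrow> f (t, x) = 0" and "norm x > R"
  shows "partial (a, b) f (t, x) = 0"
proof -
  have "open (UNIV \<times> {y :: real^'n. norm y > R} :: (real \<times> (real^'n)) set)"
    by (intro open_Times open_UNIV open_Collect_less continuous_intros)
  then have "(f has_derivative (\<lambda>_. 0)) (at (t, x))"
    by (rule has_derivative_transform_within_open[OF has_derivative_const]) (use assms in auto)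
  then show ?thesis by (simp add: partial_eq)
qed


section \<open>Integration over space-time\<close>

text \<open>The class in which all integrals below are taken. It asks for just enough decay in time for
  absolute integrability, and it is stable under multiplication by functions that are bounded
  over the ball, such as exponentials in the space variable with real or complex exponents.\<close>

definition tame :: "real \<Rightarrow> (real \<times> 'a::euclidean_space \<Rightarrow> complex) \<Rightarrow> bool" where
  "tame R f \<longleftrightarrow> continuous_on UNIV f \<and>
     (\<exists>C. \<forall>t x. norm (f (t, x)) \<le> C * inverse (1 + t\<^sup>2)) \<and>
     (\<forall>t x. norm x > R \<longrightarrow> f (t, x) = 0)"

lemma tame_continuous: "tame R f \<Longrightarrow> continuous_on UNIV f"
  by (simp add: tame_def)

lemma tame_bound:
  assumes "tame R f"
  shows "\<exists>C\<ge>0. \<forall>t x. norm (f (t, x)) \<le> C * inverse (1 + t\<^sup>2)"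
proof -
  obtain C where C: "\<And>t x. norm (f (t, x)) \<le> C * inverse (1 + t\<^sup>2)"
    using assms unfolding tame_def by blast
  have "0 \<le> norm (f (0, undefined))" by simp
  also have "\<dots> \<le> C" using C[of 0] by simp
  finally show ?thesis using C by blast
qed

lemma tame_zero: "tame R f \<Longrightarrow> norm x > R \<Longrightarrow> f (t, x) = 0"
  by (simp add: tame_def)

lemma tame_add:
  assumes "tame R f" "tame R g"
  shows "tame R (\<lambda>p. f p + g p)"
proof -
  obtain C where "C \<ge> 0" and C: "\<And>t x. norm (f (t, x)) \<le> C * inverse (1 + t\<^sup>2)"
    using tame_bound[OF assms(1)] by blast
  obtain D where "D \<ge> 0" and D: "\<And>t x. norm (g (t, x)) \<le> D * inverse (1 + t\<^sup>2)"
    using tame_bound[OF assms(2)] by blast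
  have "norm (f (t, x) + g (t, x)) \<le> (C + D) * inverse (1 + t\<^sup>2)" for t x
    using norm_triangle_mono[OF C D, of t x t x] by (simp add: distrib_right)
  then show ?thesis
    using assms unfolding tame_def by (auto intro!: continuous_intros)
qed

lemma tame_mult:
  assumes f: "tame R f" and g: "continuous_on UNIV g"
    and B: "\<And>t x. norm x \<le> R \<Longrightarrow> norm (g (t, x)) \<le> B"
  shows "tame R (\<lambda>p. g p * f p)"
proof -
  obtain C where C0: "C \<ge> 0" and C: "\<And>t x. norm (f (t, x)) \<le> C * inverse (1 + t\<^sup>2)"
    using tame_bound[OF f] by blast
  have "norm (g (t, x) * f (t, x)) \<le> (\<bar>B\<bar> * C) * inverse (1 + t\<^sup>2)" for t x
  proof (cases "norm x \<le> R")
    case True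
    have "norm (g (t, x) * f (t, x)) \<le> \<bar>B\<bar> * (C * inverse (1 + t\<^sup>2))"
      unfolding norm_mult using B[OF True, of t] C[of t x] by (intro mult_mono) auto
    then show ?thesis by (simp add: mult.assoc)
  next
    case False
    have "0 \<le> (\<bar>B\<bar> * C) * inverse (1 + t\<^sup>2)" using C0 by simp
    then show ?thesis using tame_zero[OF f] False by simp
  qed
  then show ?thesis
    using f g unfolding tame_def by (auto intro!: continuous_intros)
qed

lemma tame_cmult: "tame R f \<Longrightarrow> tame R (\<lambda>p. c * f p)"
  by (rule tame_mult[where B = "norm c"]) auto

lemma tame_diff: "tame R f \<Longrightarrow> tame R g \<Longrightarrow> tame R (\<lambda>p. f p - g p)"
  using tame_add[of R f "\<lambda>p. (-1) * g p"] tame_cmult[of R g "-1"] by simp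

lemma tame_zero_fun: "tame R (\<lambda>p. 0)"
  unfolding tame_def by (auto intro: exI[of _ 0])

lemma tame_sum: "(\<And>i. i \<in> I \<Longrightarrow> tame R (f i)) \<Longrightarrow> tame R (\<lambda>p. \<Sum>i\<in>I. f i p)"
  by (induction I rule: infinite_finite_induct) (auto intro: tame_zero_fun tame_add)

lemma integrable_inverse_1_plus_square_real: "integrable lborel (\<lambda>t::real. inverse (1 + t\<^sup>2))"
  using integrable_inverse_1_plus_square by (simp add: set_integrable_def)

lemma tame_of_decay:
  fixes f :: "real \<times> 'a::euclidean_space \<Rightarrow> complex"
  assumes "continuous_on UNIV f" and decay: "\<exists>C\<ge>0. \<forall>t x. (1 + \<bar>t\<bar>) powr 2 * norm (f (t, x)) \<le> C"
    and "\<And>t x. norm x > R \<Longrightarrow> f (t, x) = 0"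
  shows "tame R f"
proof -
  obtain C where C: "\<And>t x. (1 + \<bar>t\<bar>) powr 2 * norm (f (t, x)) \<le> C"
    using decay by blast
  have "norm (f (t, x)) \<le> C * inverse (1 + t\<^sup>2)" for t x
  proof -
    have "(1 + t\<^sup>2) * norm (f (t, x)) \<le> (1 + \<bar>t\<bar>) powr 2 * norm (f (t, x))"
      by (intro mult_right_mono) (auto simp: powr_numeral power2_eq_square algebra_simps)
    also have "\<dots> \<le> C" by (rule C)
    finally show ?thesis
      by (simp add: divide_inverse[symmetric] pos_le_divide_eq add_pos_nonneg mult.commute)
  qed
  then show ?thesis using assms unfolding tame_def by blast
qed

text \<open>For fixed \<open>t\<close> the integrand lives on a translate of the ball of radius \<open>R\<close>, whose volume does
  not depend on \<open>t\<close>; so its \<open>L\<^sup>1\<close> norm over space is at most a constant times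
  \<open>1 / (1 + t\<^sup>2)\<close>.\<close>

lemma tame_shear_integrable:
  fixes f :: "real \<times> 'a::euclidean_space \<Rightarrow> complex"
  assumes f: "tame R f"
  shows "integrable (lborel \<Otimes>\<^sub>M lborel) (\<lambda>(t, y). f (t, y + t *\<^sub>R w))"
proof -
  obtain C where C0: "C \<ge> 0" and C: "\<And>t x. norm (f (t, x)) \<le> C * inverse (1 + t\<^sup>2)"
    using tame_bound[OF f] by blast
  have cont: "continuous_on UNIV (\<lambda>(t, y). f (t, y + t *\<^sub>R w))"
    unfolding case_prod_beta
    by (intro continuous_on_compose2[OF tame_continuous[OF f]] continuous_intros) auto
  have contx: "continuous_on UNIV (\<lambda>y. f (t, y + t *\<^sub>R w))" for t
    by (intro continuous_on_compose2[OF tame_continuous[OF f]] continuous_intros) auto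
  have meas: "(\<lambda>(t, y). f (t, y + t *\<^sub>R w)) \<in> borel_measurable (lborel \<Otimes>\<^sub>M lborel)"
    unfolding lborel_prod using borel_measurable_continuous_onI[OF cont] by simp
  define V where "V = measure lborel (cball (0::'a) R)"
  have shift: "cball (- (t *\<^sub>R w)) R \<in> sets lborel" "emeasure lborel (cball (- (t *\<^sub>R w)) R) < \<infinity>" 
    for t using emeasure_bounded_finite[OF bounded_cball] by simp_all
  have dom: "norm (f (t, y + t *\<^sub>R w)) \<le> 
      C * inverse (1 + t\<^sup>2) * indicator (cball (- (t *\<^sub>R w)) R) y" for t y
    using C[of t "y + t *\<^sub>R w"] tame_zero[OF f, of "y + t *\<^sub>R w" t]
    by (auto simp: indicator_def dist_norm norm_minus_commute algebra_simps)
  have domint: "integrable lborel (\<lambda>y. C * inverse (1 + t\<^sup>2) * indicator (cball (- (t *\<^sub>R w)) R) y)" for t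
    using shift by (intro integrable_mult_right) (auto intro!: integrable_real_indicator)
  have int: "integrable lborel (\<lambda>y. f (t, y + t *\<^sub>R w))" for t
    by (rule Bochner_Integration.integrable_bound[OF domint])
       (use borel_measurable_continuous_onI[OF contx] dom C0 in auto)
  have dist_minus_left: "dist (- a) y = norm (a + y)" for a y :: 'a
    unfolding dist_norm by (subst norm_minus_cancel[symmetric]) simp
  have V: "measure lborel (cball (- (t *\<^sub>R w)) R) = V" for t
  proof -
    have "emeasure lborel (cball (0::'a) R) = emeasure (distr lborel borel ((+) (t *\<^sub>R w))) (cball (0::'a) R)"
      by (simp add: lborel_distr_plus)
    also have "\<dots> = emeasure lborel ((+) (t *\<^sub>R w) -` cball 0 R \<inter> space lborel)"
      by (rule emeasure_distr) auto
    also have "(+) (t *\<^sub>R w) -` cball 0 R \<inter> space lborel = cball (- (t *\<^sub>R w)) R"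
      by (auto simp: dist_minus_left)
    finally show ?thesis by (simp add: V_def measure_def)
  qed
  have "integrable lborel (\<lambda>t. LINT y|lborel. norm (f (t, y + t *\<^sub>R w)))"
  proof (rule Bochner_Integration.integrable_bound)
    show "integrable lborel (\<lambda>t. C * V * inverse (1 + t\<^sup>2))"
      by (intro integrable_mult_right integrable_inverse_1_plus_square_real)
    have "(LINT y|lborel. norm (f (t, y + t *\<^sub>R w))) \<le> C * V * inverse (1 + t\<^sup>2)" for t
    proof -
      have "(LINT y|lborel. norm (f (t, y + t *\<^sub>R w))) \<le> 
          (LINT y|lborel. C * inverse (1 + t\<^sup>2) * indicator (cball (- (t *\<^sub>R w)) R) y)"
        using int dom by (intro integral_mono integrable_norm domint) auto
      also have "\<dots> = C * inverse (1 + t\<^sup>2) * V"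
        by (simp add: V)
      finally show ?thesis by (simp add: ac_simps)
    qed
    moreover have "0 \<le> (LINT y|lborel. norm (f (t, y + t *\<^sub>R w)))" for t by simp
    ultimately show "AE t in lborel. norm (LINT y|lborel. norm (f (t, y + t *\<^sub>R w)))
        \<le> norm (C * V * inverse (1 + t\<^sup>2))" by (intro AE_I2) (smt (verit) real_norm_def)
    have "(\<lambda>p. norm (case p of (t, y) \<Rightarrow> f (t, y + t *\<^sub>R w))) \<in> borel_measurable (lborel \<Otimes>\<^sub>M lborel)"
      using measurable_compose[OF meas borel_measurable_norm] by simp
    then show "(\<lambda>t. LINT y|lborel. norm (f (t, y + t *\<^sub>R w))) \<in> borel_measurable lborel"
      by (intro lborel.borel_measurable_lebesgue_integral) (simp add: case_prod_beta')
  qed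
  then show ?thesis
    by (intro lborel_pair.Fubini_integrable[OF meas]) (use int in auto)
qed

lemma tame_integrable: "tame R f \<Longrightarrow> integrable lborel f"
  using tame_shear_integrable[of R f 0] by (simp add: lborel_prod)

text \<open>Lebesgue measure on space-time is fibred over the lines with direction \<open>(1, w)\<close>: shifting the
  time slice at \<open>t\<close> by \<open>t w\<close> preserves the measure. For \<open>\<bar>w\<bar> = 1\<close> the lines are light rays;
  with \<open>w = 0\<close> or a coordinate vector the formula also serves to integrate by parts.\<close>

lemma integral_shear:
  fixes f :: "real \<times> 'a::euclidean_space \<Rightarrow> complex"
  assumes f: "tame R f"
  shows "(LINT p|lborel. f p) = (LINT y|lborel. LINT t|lborel. f (t, y + t *\<^sub>R w))"
proof -
  have "(LINT p|lborel. f p) = (LINT t|lborel. LINT x|lborel. f (t, x))"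
    unfolding lborel_prod[symmetric] 
    using tame_integrable[OF f] lborel_pair.integral_fst'[of f] by (simp add: lborel_prod)
  also have "\<dots> = (LINT t|lborel. LINT y|lborel. f (t, y + t *\<^sub>R w))"
  proof (rule Bochner_Integration.integral_cong[OF refl])
    fix t :: real
    have contx: "continuous_on UNIV (\<lambda>y. f (t, y))"
      by (intro continuous_on_compose2[OF tame_continuous[OF f]] continuous_intros) auto
    have "(LINT x|lborel. f (t, x)) = (LINT x|distr lborel borel ((+) (t *\<^sub>R w)). f (t, x))"
      by (simp add: lborel_distr_plus)
    also have "\<dots> = (LINT y|lborel. f (t, t *\<^sub>R w + y))"
      using borel_measurable_continuous_onI[OF contx] by (intro integral_distr) auto
    finally show "(LINT x|lborel. f (t, x)) = (LINT y|lborel. f (t, y + t *\<^sub>R w))"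
      by (simp add: add.commute)
  qed
  also have "\<dots> = (LINT y|lborel. LINT t|lborel. f (t, y + t *\<^sub>R w))"
    using lborel_pair.Fubini_integral[of "\<lambda>t y. f (t, y + t *\<^sub>R w)"] tame_shear_integrable[OF f, of w]
    by simp
  finally show ?thesis .
qed

lemma
  fixes h :: "real \<Rightarrow> complex"
  assumes "\<And>t. norm (h t) \<le> C * inverse (1 + t\<^sup>2)"
  shows tendsto_zero_at_top_of_bound: "(h \<longlongrightarrow> 0) at_top"
    and tendsto_zero_at_bot_of_bound: "(h \<longlongrightarrow> 0) at_bot"
    and integrable_of_bound: "continuous_on UNIV h \<Longrightarrow> integrable lborel h"
proof -
  have lim: "((\<lambda>t::real. C * inverse (1 + t\<^sup>2)) \<longlongrightarrow> 0) at_top" 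
    "((\<lambda>t::real. C * inverse (1 + t\<^sup>2)) \<longlongrightarrow> 0) at_bot"
    by real_asymp+
  show "(h \<longlongrightarrow> 0) at_top" "(h \<longlongrightarrow> 0) at_bot"
    by (rule tendsto_0_le[OF lim(1), of _ 1] tendsto_0_le[OF lim(2), of _ 1]; 
        use assms in \<open>auto intro!: always_eventually intro: order_trans[OF _ abs_ge_self]\<close>)+
  assume "continuous_on UNIV h"
  show "integrable lborel h"
  proof (rule Bochner_Integration.integrable_bound)
    show "integrable lborel (\<lambda>t. C * inverse (1 + t\<^sup>2))"
      by (intro integrable_mult_right integrable_inverse_1_plus_square_real)
    show "h \<in> borel_measurable lborel"
      using borel_measurable_continuous_onI[OF \<open>continuous_on UNIV h\<close>] by simp
    show "AE t in lborel. norm (h t) \<le> norm (C * inverse (1 + t\<^sup>2))"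
      using assms by (auto intro: order_trans[OF _ abs_ge_self])
  qed
qed

lemma integral_derivative_eq_zero:
  fixes h h' :: "real \<Rightarrow> complex"
  assumes deriv: "\<And>t. (h has_vector_derivative h' t) (at t)" and cont: "continuous_on UNIV h'"
    and C: "\<And>t. norm (h t) \<le> C * inverse (1 + t\<^sup>2)"
    and D: "\<And>t. norm (h' t) \<le> D * inverse (1 + t\<^sup>2)"
  shows "(LINT t|lborel. h' t) = 0"
proof -
  have "(LBINT t=-\<infinity>..\<infinity>. h' t) = 0 - 0"
  proof (rule interval_integral_FTC_integrable[where F = h])
    show "set_integrable lborel (einterval (- \<infinity>) \<infinity>) h'"
      using integrable_of_bound[OF D cont] by (simp add: set_integrable_def)
    show "((h \<circ> real_of_ereal) \<longlongrightarrow> 0) (at_right (- \<infinity>))" "((h \<circ> real_of_ereal) \<longlongrightarrow> 0) (at_left \<infinity>)"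
      using tendsto_zero_at_top_of_bound[OF C] tendsto_zero_at_bot_of_bound[OF C] by (simp_all add: ereal_tendsto_simps)
  qed (use deriv cont in \<open>auto simp: continuous_on_eq_continuous_at\<close>)
  then show ?thesis
    by (simp add: interval_lebesgue_integral_def set_lebesgue_integral_def)
qed


section \<open>The Fourier--Laplace transform\<close>

text \<open>The spatial frequency is \<open>z \<theta>\<close> with a real direction \<open>\<theta>\<close> and a complex factor \<open>z\<close>: imaginary
  \<open>z\<close> gives the Fourier transform, \<open>z = 1\<close> the two-sided Laplace transform in space, and
  holomorphy in the single variable \<open>z\<close> connects the two.\<close>

definition phase :: "real \<Rightarrow> complex \<Rightarrow> 'a::euclidean_space \<Rightarrow> real \<times> 'a \<Rightarrow> complex" where
  "phase \<tau> z \<theta> p = exp (z * of_real (\<theta> \<bullet> snd p) - \<i> * of_real (\<tau> * fst p))"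

definition fourier_laplace :: "(real \<times> 'a::euclidean_space \<Rightarrow> complex) \<Rightarrow> real \<Rightarrow> complex \<Rightarrow> 'a \<Rightarrow> complex" where
  "fourier_laplace f \<tau> z \<theta> = (LINT p|lborel. phase \<tau> z \<theta> p * f p)"

lemma continuous_phase: "continuous_on UNIV (phase \<tau> z \<theta>)"
  unfolding phase_def by (intro continuous_intros)

lemma inner_le_radius:
  fixes \<theta> x :: "'a::real_inner"
  assumes "norm x \<le> R"
  shows "\<bar>\<theta> \<bullet> x\<bar> \<le> norm \<theta> * R"
  using Cauchy_Schwarz_ineq2[of \<theta> x] mult_left_mono[OF assms, of "norm \<theta>"] norm_ge_zero[of \<theta>] by linarith

lemma tame_phase:
  assumes "tame R f"
  shows "tame R (\<lambda>p. phase \<tau> z \<theta> p * f p)"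
proof (rule tame_mult[OF assms continuous_phase])
  fix t :: real and x :: 'a
  assume x: "norm x \<le> R"
  have "Re z * (\<theta> \<bullet> x) \<le> \<bar>Re z\<bar> * (norm \<theta> * R)"
    using mult_left_mono[OF inner_le_radius[OF x, of \<theta>], of "\<bar>Re z\<bar>"]
      abs_ge_self[of "Re z * (\<theta> \<bullet> x)"] unfolding abs_mult by linarith
  then show "norm (phase \<tau> z \<theta> (t, x)) \<le> exp (\<bar>Re z\<bar> * (norm \<theta> * R))"
    by (simp add: phase_def)
qed

lemma integrable_phase: "tame R f \<Longrightarrow> integrable lborel (\<lambda>p. phase \<tau> z \<theta> p * f p)"
  by (rule tame_integrable[OF tame_phase])

lemma fourier_laplace_add: "tame R f \<Longrightarrow> tame R g \<Longrightarrow> fourier_laplace (\<lambda>p. f p + g p) \<tau> z \<theta> = fourier_laplace f \<tau> z \<theta> + fourier_laplace g \<tau> z \<theta>"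
  by (simp add: fourier_laplace_def distrib_left integrable_phase)

lemma fourier_laplace_diff: "tame R f \<Longrightarrow> tame R g \<Longrightarrow> fourier_laplace (\<lambda>p. f p - g p) \<tau> z \<theta> = fourier_laplace f \<tau> z \<theta> - fourier_laplace g \<tau> z \<theta>"
  by (simp add: fourier_laplace_def right_diff_distrib integrable_phase)

lemma fourier_laplace_cmult: "fourier_laplace (\<lambda>p. c * f p) \<tau> z \<theta> = c * fourier_laplace f \<tau> z \<theta>"
  by (simp add: fourier_laplace_def mult.left_commute)

lemma fourier_laplace_sum:
  assumes "\<And>i. i \<in> I \<Longrightarrow> tame R (f i)"
  shows "fourier_laplace (\<lambda>p. \<Sum>i\<in>I. f i p) \<tau> z \<theta> = (\<Sum>i\<in>I. fourier_laplace (f i) \<tau> z \<theta>)"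
  unfolding fourier_laplace_def sum_distrib_left
  by (rule Bochner_Integration.integral_sum) (rule integrable_phase[OF assms])

text \<open>Expand \<open>exp (z \<theta> \<bullet> x)\<close> and integrate term by term: on the support of \<open>f\<close> the exponent is
  bounded by \<open>\<bar>z\<bar> \<bar>\<theta>\<bar> R\<close>, so the series of integrals is dominated by an exponential series.\<close>

lemma fourier_laplace_entire:
  assumes f: "tame R f"
  shows "(\<lambda>z. fourier_laplace f \<tau> z \<theta>) holomorphic_on UNIV"
proof -
  define e where "e = phase \<tau> 0 \<theta>"
  define c where "c p = complex_of_real (\<theta> \<bullet> snd p)" for p :: "real \<times> 'a"
  define B where "B = norm \<theta> * R"
  have norm_e: "norm (e p) = 1" for p
    by (simp add: e_def phase_def)
  have c_le: "norm (c p) ^ k * norm (f p) \<le> B ^ k * norm (f p)" for p k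
  proof (cases "norm (snd p) \<le> R")
    case True
    show ?thesis
      using inner_le_radius[OF True, of \<theta>]
      by (intro mult_right_mono power_mono) (auto simp: c_def B_def)
  next
    case False
    then show ?thesis using tame_zero[OF f, of "snd p" "fst p"] by simp
  qed
  have term_tame: "tame R (\<lambda>p. (e p * (z * c p) ^ k / fact k) * f p)" for z k
  proof (rule tame_mult[OF f])
    show "continuous_on UNIV (\<lambda>p. e p * (z * c p) ^ k / fact k)"
      unfolding c_def e_def by (intro continuous_intros continuous_phase) auto
    fix t :: real and x :: 'a assume x: "norm x \<le> R"
    have "norm (c (t, x)) \<le> B"
      using inner_le_radius[OF x, of \<theta>] by (simp add: c_def B_def)
    then have "norm (z * c (t, x)) ^ k \<le> (norm z * B) ^ k"
      by (intro power_mono) (auto simp: norm_mult mult_left_mono)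
    then show "norm (e (t, x) * (z * c (t, x)) ^ k / fact k) \<le> (norm z * B) ^ k / fact k"
      by (simp add: norm_mult norm_divide norm_power norm_e divide_right_mono)
  qed
  have exp_sums: "(\<lambda>k. (e p * (z * c p) ^ k / fact k) * f p) sums (phase \<tau> z \<theta> p * f p)" for p z
  proof -
    have "phase \<tau> z \<theta> p = e p * exp (z * c p)"
      by (simp add: phase_def e_def c_def exp_diff exp_minus field_simps)
    moreover have "(\<lambda>k. e p * ((z * c p) ^ k /\<^sub>R fact k) * f p) sums (e p * exp (z * c p) * f p)"
      by (intro sums_mult sums_mult2 exp_converges)
    ultimately show ?thesis
      by (simp add: scaleR_conv_of_real field_simps)
  qed
  have summ: "summable (\<lambda>k. norm z ^ k * B ^ k / fact k)" for z :: complex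
    using summable_exp[of "norm z * B"] by (simp add: power_mult_distrib field_simps)
  have bnd: "norm ((e p * (z * c p) ^ k / fact k) * f p) \<le> (norm z ^ k * B ^ k / fact k) * norm (f p)"
    for p z k
  proof -
    have "norm ((e p * (z * c p) ^ k / fact k) * f p) = norm z ^ k / fact k * (norm (c p) ^ k * norm (f p))"
      by (simp add: norm_mult norm_divide norm_power norm_e power_mult_distrib)
    also have "\<dots> \<le> norm z ^ k / fact k * (B ^ k * norm (f p))"
      by (intro mult_left_mono c_le) auto
    finally show ?thesis by (simp add: field_simps)
  qed
  define a where "a k = (LINT p|lborel. (e p * c p ^ k / fact k) * f p)" for k
  have "(\<lambda>k. a k * (z - 0) ^ k) sums fourier_laplace f \<tau> z \<theta>" for z
  proof -
    have int: "integrable lborel (\<lambda>p. (e p * (z * c p) ^ k / fact k) * f p)" for k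
      by (rule tame_integrable[OF term_tame])
    have "(\<lambda>k. LINT p|lborel. (e p * (z * c p) ^ k / fact k) * f p) sums
        (LINT p|lborel. (\<Sum>k. (e p * (z * c p) ^ k / fact k) * f p))"
    proof (rule sums_integral[OF int])
      show "AE p in lborel. summable (\<lambda>k. norm ((e p * (z * c p) ^ k / fact k) * f p))"
      proof (intro AE_I2)
        fix p
        show "summable (\<lambda>k. norm ((e p * (z * c p) ^ k / fact k) * f p))"
          by (rule summable_comparison_test'[OF summable_mult2[OF summ]]) (use bnd in simp)
      qed
      show "summable (\<lambda>k. LINT p|lborel. norm ((e p * (z * c p) ^ k / fact k) * f p))"
      proof (rule summable_comparison_test'[OF summable_mult2[OF summ]])
        fix k :: nat
        have "(LINT p|lborel. norm ((e p * (z * c p) ^ k / fact k) * f p)) \<le>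
            (LINT p|lborel. (norm z ^ k * B ^ k / fact k) * norm (f p))"
          using int bnd tame_integrable[OF f] 
          by (intro integral_mono integrable_norm integrable_mult_right) auto
        then show "norm (LINT p|lborel. norm ((e p * (z * c p) ^ k / fact k) * f p)) \<le>
            (norm z ^ k * B ^ k / fact k) * (LINT p|lborel. norm (f p))"
          by simp
      qed
    qed
    moreover have "(LINT p|lborel. (e p * (z * c p) ^ k / fact k) * f p) = a k * (z - 0) ^ k" for k
    proof -
      have "(e p * (z * c p) ^ k / fact k) * f p = z ^ k * ((e p * c p ^ k / fact k) * f p)" for p
        by (simp add: power_mult_distrib)
      then show ?thesis
        by (simp only: a_def integral_mult_right_zero) simp
    qed
    moreover have "(\<Sum>k. (e p * (z * c p) ^ k / fact k) * f p) = phase \<tau> z \<theta> p * f p" for p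
      using exp_sums by (rule sums_unique[symmetric])
    ultimately show ?thesis by (simp add: fourier_laplace_def)
  qed
  then have "(\<lambda>z. fourier_laplace f \<tau> z \<theta>) holomorphic_on ball 0 r" for r
    by (intro power_series_holomorphic)
  then have "(\<lambda>z. fourier_laplace f \<tau> z \<theta>) field_differentiable at w" for w
    by (rule holomorphic_on_imp_differentiable_at[of _ "ball 0 (norm w + 1)"]) auto
  then show ?thesis
    by (simp add: holomorphic_on_def)
qed

lemma entire_eq_zero_of_imaginary_ray:
  assumes h: "h holomorphic_on UNIV" and zero: "\<And>s::real. s > S \<Longrightarrow> h (\<i> * of_real s) = 0"
  shows "h z = 0"
proof (rule analytic_continuation[OF h open_UNIV connected_UNIV subset_UNIV UNIV_I _ _ UNIV_I])
  let ?U = "(\<lambda>s. \<i> * of_real s) ` {s. s > S}"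
  show "\<i> * of_real (S + 1) islimpt ?U"
    unfolding islimpt_approachable
  proof (intro allI impI)
    fix e :: real assume "e > 0"
    have "dist (\<i> * of_real (S + 1 + e / 2)) (\<i> * of_real (S + 1)) = norm (\<i> * of_real (e / 2))"
      by (simp add: dist_norm algebra_simps)
    also have "\<dots> < e" using \<open>e > 0\<close> by (simp add: norm_mult del: of_real_divide)
    finally show "\<exists>x'\<in>?U. x' \<noteq> \<i> * of_real (S + 1) \<and> dist x' (\<i> * of_real (S + 1)) < e"
      using \<open>e > 0\<close> by (intro bexI[of _ "\<i> * of_real (S + 1 + e / 2)"] image_eqI[of _ _ "S + 1 + e / 2"]) 
        (auto simp del: of_real_add of_real_divide)
  qed
  show "h w = 0" if "w \<in> ?U" for w using that zero by auto
qed

text \<open>The condition on \<open>s\<close> makes the phase constant along each line with direction \<open>(1, \<omega>)\<close>.\<close>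

lemma fourier_laplace_light_ray:
  fixes f :: "real \<times> 'a::euclidean_space \<Rightarrow> complex"
  assumes f: "tame R f" and ray: "\<And>y. (LINT t|lborel. f (t, y + t *\<^sub>R \<omega>)) = 0"
    and s: "s * (\<theta> \<bullet> \<omega>) = \<tau>"
  shows "fourier_laplace f \<tau> (\<i> * of_real s) \<theta> = 0"
proof -
  have const: "phase \<tau> (\<i> * of_real s) \<theta> (t, y + t *\<^sub>R \<omega>) = exp (\<i> * of_real (s * (\<theta> \<bullet> y)))" for t y
    unfolding phase_def s[symmetric] by (simp add: algebra_simps)
  show ?thesis
    unfolding fourier_laplace_def integral_shear[OF tame_phase[OF f], of _ _ _ \<omega>] const by (simp add: ray)
qed

text \<open>Integration by parts along the lines with direction \<open>(1, w)\<close>. The choice \<open>w = 0\<close> gives the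
  time derivative, and subtracting it from the case of a coordinate vector \<open>w\<close> gives the
  derivative in that space coordinate; both cases use the same fibration into lines.\<close>

lemma fourier_laplace_derivative:
  fixes f f' :: "real \<times> 'a::euclidean_space \<Rightarrow> complex"
  assumes f: "tame R f" and f': "tame R f'"
    and deriv: "\<And>t y. ((\<lambda>t. f (t, y + t *\<^sub>R w)) has_vector_derivative f' (t, y + t *\<^sub>R w)) (at t)"
  shows "fourier_laplace f' \<tau> 1 \<theta> = (\<i> * of_real \<tau> - of_real (\<theta> \<bullet> w)) * fourier_laplace f \<tau> 1 \<theta>"
proof -
  define c where "c = of_real (\<theta> \<bullet> w) - \<i> * of_real \<tau>"
  define u where "u p = phase \<tau> 1 \<theta> p * f p" for p
  define u' where "u' p = phase \<tau> 1 \<theta> p * f' p + c * (phase \<tau> 1 \<theta> p * f p)" for p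
  have u: "tame R u" and u': "tame R u'"
    unfolding u_def u'_def using f f' by (intro tame_add tame_cmult tame_phase; simp)+
  have "(LINT p|lborel. u' p) = (LINT y|lborel. LINT t|lborel. u' (t, y + t *\<^sub>R w))"
    by (rule integral_shear[OF u'])
  also have "\<dots> = (LINT y|(lborel::'a measure). 0)"
  proof (rule Bochner_Integration.integral_cong[OF refl])
    fix y :: 'a
    obtain C where C: "\<And>t x. norm (u (t, x)) \<le> C * inverse (1 + t\<^sup>2)" using tame_bound[OF u] by blast
    obtain D where D: "\<And>t x. norm (u' (t, x)) \<le> D * inverse (1 + t\<^sup>2)" using tame_bound[OF u'] by blast
    have ph: "phase \<tau> 1 \<theta> (t, y + t *\<^sub>R w) = exp (of_real (\<theta> \<bullet> y) + of_real t * c)" for t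
      by (simp add: phase_def c_def algebra_simps)
    have dph: "((\<lambda>t. phase \<tau> 1 \<theta> (t, y + t *\<^sub>R w)) has_vector_derivative c * phase \<tau> 1 \<theta> (t, y + t *\<^sub>R w)) (at t)" for t
    proof -
      have "((\<lambda>t. of_real (\<theta> \<bullet> y) + of_real t * c) has_vector_derivative c) (at t)"
        by (auto intro!: derivative_eq_intros)
      moreover have "(exp has_field_derivative exp (of_real (\<theta> \<bullet> y) + of_real t * c)) 
          (at (of_real (\<theta> \<bullet> y) + of_real t * c))" by (rule DERIV_exp)
      ultimately show ?thesis
        unfolding ph using field_vector_diff_chain_at[unfolded o_def] by blast
    qed
    show "(LINT t|lborel. u' (t, y + t *\<^sub>R w)) = 0"
    proof (rule integral_derivative_eq_zero[OF _ _ C D])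
      show "((\<lambda>t. u (t, y + t *\<^sub>R w)) has_vector_derivative u' (t, y + t *\<^sub>R w)) (at t)" for t
        unfolding u_def u'_def
        using has_vector_derivative_mult[OF dph[of t] deriv[of y t]] by (simp add: mult.assoc)
      show "continuous_on UNIV (\<lambda>t. u' (t, y + t *\<^sub>R w))"
        by (intro continuous_on_compose2[OF tame_continuous[OF u']] continuous_intros) auto
    qed
  qed
  finally have "(LINT p|lborel. u' p) = 0" by simp
  moreover have "(LINT p|lborel. u' p) = fourier_laplace f' \<tau> 1 \<theta> + c * fourier_laplace f \<tau> 1 \<theta>"
    unfolding u'_def fourier_laplace_def using f f'
    by (subst Bochner_Integration.integral_add) (auto intro!: integrable_mult_right integrable_phase)
  ultimately show ?thesis
    by (simp add: c_def algebra_simps add_eq_0_iff)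
qed


section \<open>Injectivity of the transform\<close>

text \<open>Multiplying a function by an exponential translates its transform, so the space of functions with
  vanishing transform is a module over the algebra generated by exponentials, and the
  continuous functions \<open>g\<close> for which multiplication by \<open>g\<close> preserves it are closed under sums
  and products.\<close>

definition annihilated :: "real \<Rightarrow> (real \<times> 'a::euclidean_space \<Rightarrow> complex) \<Rightarrow> bool" where
  "annihilated R f \<longleftrightarrow> tame R f \<and> (\<forall>\<tau> \<theta>. fourier_laplace f \<tau> 1 \<theta> = 0)"

lemma annihilated_add: "annihilated R f \<Longrightarrow> annihilated R g \<Longrightarrow> annihilated R (\<lambda>p. f p + g p)"
  by (auto simp: annihilated_def tame_add fourier_laplace_add)

lemma annihilated_cmult: "annihilated R f \<Longrightarrow> annihilated R (\<lambda>p. c * f p)"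
  by (auto simp: annihilated_def tame_cmult fourier_laplace_cmult)

lemma annihilated_phase:
  assumes "annihilated R f"
  shows "annihilated R (\<lambda>p. phase \<sigma> 1 b p * f p)"
proof -
  have "phase \<tau> 1 \<theta> p * (phase \<sigma> 1 b p * f p) = phase (\<tau> + \<sigma>) 1 (\<theta> + b) p * f p" for \<tau> \<theta> p
    unfolding mult.assoc[symmetric] phase_def exp_add[symmetric] by (simp add: algebra_simps)
  then have "fourier_laplace (\<lambda>p. phase \<sigma> 1 b p * f p) \<tau> 1 \<theta> = fourier_laplace f (\<tau> + \<sigma>) 1 (\<theta> + b)" for \<tau> \<theta>
    unfolding fourier_laplace_def by (simp only:)
  then show ?thesis
    using assms by (simp add: annihilated_def tame_phase)
qed

lemma annihilated_integral: "annihilated R f \<Longrightarrow> (LINT p|lborel. f p) = 0"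
  unfolding annihilated_def fourier_laplace_def by (drule conjunct2, drule spec[of _ 0], drule spec[of _ 0]) (simp add: phase_def)

text \<open>Stone--Weierstrass needs a compact domain, while time ranges over the whole line. The time
  variable is therefore wrapped around the unit circle with angular frequency \<open>w\<close>, and the
  multipliers are functions on the product of the circle with the ball.\<close>

definition multiplier :: "real \<Rightarrow> real \<Rightarrow> (complex \<times> 'a::euclidean_space \<Rightarrow> real) \<Rightarrow> bool" where
  "multiplier R w g \<longleftrightarrow> continuous_on UNIV g \<and>
     (\<forall>f. annihilated R f \<longrightarrow>
        annihilated R (\<lambda>p. complex_of_real (g (cis (w * fst p), snd p)) * f p))"

lemma multiplier_cos: "multiplier R w (\<lambda>q. Re (fst q))"
proof -
  have "annihilated R (\<lambda>p. complex_of_real (Re (cis (w * fst p))) * f p)"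
    if f: "annihilated R f" for f :: "real \<times> 'a \<Rightarrow> complex"
  proof -
    have "complex_of_real (Re (cis (w * fst p))) * f p =
        (1/2) * (phase (- w) 1 0 p * f p) + (1/2) * (phase w 1 0 p * f p)" for p
      by (simp add: phase_def cos_of_real[symmetric] cos_exp_eq algebra_simps exp_minus)
    then show ?thesis
      by (simp only:) (intro annihilated_add annihilated_cmult annihilated_phase f)
  qed
  then show ?thesis
    unfolding multiplier_def by (auto intro!: continuous_intros)
qed

lemma multiplier_sin: "multiplier R w (\<lambda>q. Im (fst q))"
proof -
  have "annihilated R (\<lambda>p. complex_of_real (Im (cis (w * fst p))) * f p)"
    if f: "annihilated R f" for f :: "real \<times> 'a \<Rightarrow> complex"
  proof -
    have "complex_of_real (Im (cis (w * fst p))) * f p =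
        (1/(2*\<i>)) * (phase (- w) 1 0 p * f p) + (- 1/(2*\<i>)) * (phase w 1 0 p * f p)" for p
      by (simp add: phase_def sin_of_real[symmetric] sin_exp_eq field_simps exp_minus)
    then show ?thesis
      by (simp only:) (intro annihilated_add annihilated_cmult annihilated_phase f)
  qed
  then show ?thesis
    unfolding multiplier_def by (auto intro!: continuous_intros)
qed

lemma multiplier_exp: "multiplier R w (\<lambda>q. exp (b \<bullet> snd q))"
proof -
  have "annihilated R (\<lambda>p. complex_of_real (exp (b \<bullet> snd p)) * f p)"
    if f: "annihilated R f" for f :: "real \<times> 'a \<Rightarrow> complex"
    using annihilated_phase[OF f, of 0 b] by (simp add: phase_def exp_of_real)
  then show ?thesis
    unfolding multiplier_def by (auto intro!: continuous_intros)
qed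

lemma multiplier_dense:
  fixes H :: "complex \<times> 'a::euclidean_space \<Rightarrow> real"
  assumes H: "continuous_on UNIV H" and e: "e > 0"
  shows "\<exists>g. multiplier R w g \<and> (\<forall>q \<in> sphere 0 1 \<times> cball 0 R. \<bar>H q - g q\<bar> < e)"
proof (rule Stone_Weierstrass_HOL)
  show "compact (sphere (0::complex) 1 \<times> cball (0::'a) R)"
    by (intro compact_Times) auto
  show "multiplier R w (\<lambda>q. c)" for c
    by (auto simp: multiplier_def annihilated_cmult)
  show "continuous_on (sphere 0 1 \<times> cball 0 R) g" if "multiplier R w g" for g
    using that continuous_on_subset unfolding multiplier_def by blast
  show "multiplier R w (\<lambda>q. f q + g q)" if "multiplier R w f \<and> multiplier R w g" for f g
    using that unfolding multiplier_def
    by (auto simp: distrib_right intro!: continuous_intros annihilated_add)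
  show "multiplier R w (\<lambda>q. f q * g q)" if fg: "multiplier R w f \<and> multiplier R w g"
    for f g :: "complex \<times> 'a \<Rightarrow> real"
    unfolding multiplier_def
  proof (intro conjI allI impI)
    show "continuous_on UNIV (\<lambda>q. f q * g q)"
      using fg unfolding multiplier_def by (intro continuous_intros) auto
    fix h :: "real \<times> 'a \<Rightarrow> complex" assume "annihilated R h"
    then have "annihilated R (\<lambda>p. complex_of_real (g (cis (w * fst p), snd p)) * h p)"
      using fg by (auto simp: multiplier_def)
    then have "annihilated R (\<lambda>p. complex_of_real (f (cis (w * fst p), snd p)) *
        (complex_of_real (g (cis (w * fst p), snd p)) * h p))"
      using fg unfolding multiplier_def by blast
    then show "annihilated R (\<lambda>p. complex_of_real (f (cis (w * fst p), snd p) * g (cis (w * fst p), snd p)) * h p)"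
      by (simp add: mult.assoc)
  qed
  fix q q' :: "complex \<times> 'a"
  assume "q \<in> sphere 0 1 \<times> cball 0 R \<and> q' \<in> sphere 0 1 \<times> cball 0 R \<and> q \<noteq> q'"
  then consider "Re (fst q) \<noteq> Re (fst q')" | "Im (fst q) \<noteq> Im (fst q')" | "snd q \<noteq> snd q'"
    by (metis complex_eqI prod_eqI)
  then show "\<exists>g. multiplier R w g \<and> g q \<noteq> g q'"
  proof cases
    case 1 then show ?thesis using multiplier_cos by blast
  next
    case 2 then show ?thesis using multiplier_sin by blast
  next
    case 3
    then obtain b where "b \<bullet> snd q \<noteq> b \<bullet> snd q'"
      by (metis vector_eq_ldot)
    then show ?thesis
      by (intro exI[of _ "\<lambda>q. exp (b \<bullet> snd q)"]) (simp add: multiplier_exp)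
  qed
next
  show "continuous_on (sphere 0 1 \<times> cball 0 R) H"
    using H continuous_on_subset by blast
qed (rule e)

lemma tame_mult_periodic:
  fixes H :: "complex \<times> 'a::euclidean_space \<Rightarrow> real"
  assumes f: "tame R f" and H: "continuous_on UNIV H"
  shows "tame R (\<lambda>p. complex_of_real (H (cis (w * fst p), snd p)) * f p)"
proof -
  have "compact (H ` (sphere 0 1 \<times> cball 0 R))"
    by (intro compact_continuous_image compact_Times continuous_on_subset[OF H]) auto
  then have "bounded (H ` (sphere 0 1 \<times> cball 0 R))" by (rule compact_imp_bounded)
  then obtain B where B: "\<And>q. q \<in> sphere 0 1 \<times> cball 0 R \<Longrightarrow> \<bar>H q\<bar> \<le> B"
    by (auto simp: bounded_real)
  have "continuous_on UNIV (\<lambda>p. complex_of_real (H (cis (w * fst p), snd p)))"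
    by (intro continuous_on_of_real continuous_on_compose2[OF H] continuous_intros) auto
  then show ?thesis
    by (rule tame_mult[OF f, where B = B]) (use B in auto)
qed

text \<open>By density a continuous function of \<open>(cis (w t), x)\<close> is uniformly close, on the support of
  \<open>f\<close>, to a multiplier \<open>g\<close>, and \<open>g f\<close> has integral zero because it is again annihilated.\<close>

lemma annihilated_periodic_integral:
  fixes H :: "complex \<times> 'a::euclidean_space \<Rightarrow> real"
  assumes f: "annihilated R f" and H: "continuous_on UNIV H"
  shows "(LINT p|lborel. complex_of_real (H (cis (w * fst p), snd p)) * f p) = 0"
proof -
  have tame: "tame R f" using f by (simp add: annihilated_def)
  define N where "N = (LINT p|lborel. norm (f p))"
  have N0: "N \<ge> 0" by (simp add: N_def)
  have small: "norm (LINT p|lborel. complex_of_real (H (cis (w * fst p), snd p)) * f p) \<le> e * N" if e: "e > 0" for e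
  proof -
    obtain g where g: "multiplier R w g" 
      and gH: "\<And>q. q \<in> sphere 0 1 \<times> cball 0 R \<Longrightarrow> \<bar>H q - g q\<bar> < e"
      using multiplier_dense[OF H e] by blast
    have gc: "continuous_on UNIV g" using g by (simp add: multiplier_def)
    let ?F = "\<lambda>G p. complex_of_real (G (cis (w * fst p), snd p)) * f p"
    have int: "integrable lborel (?F G)" if "continuous_on UNIV G" for G
      by (rule tame_integrable[OF tame_mult_periodic[OF tame that]])
    have "annihilated R (?F g)" using g f by (auto simp: multiplier_def)
    then have "integral\<^sup>L lborel (?F H) = integral\<^sup>L lborel (?F H) - integral\<^sup>L lborel (?F g)"
      by (simp add: annihilated_integral)
    also have "\<dots> = (LINT p|lborel. ?F H p - ?F g p)"
      by (intro Bochner_Integration.integral_diff[symmetric] int H gc)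
    also have "norm \<dots> \<le> (LINT p|lborel. norm (?F H p - ?F g p))"
      by (rule integral_norm_bound)
    also have "\<dots> \<le> (LINT p|lborel. e * norm (f p))"
    proof (rule integral_mono)
      fix p :: "real \<times> 'a"
      show "norm (?F H p - ?F g p) \<le> e * norm (f p)"
      proof (cases "norm (snd p) \<le> R")
        case True
        then have "\<bar>H (cis (w * fst p), snd p) - g (cis (w * fst p), snd p)\<bar> < e"
          by (intro gH) auto
        then show ?thesis
          by (simp add: left_diff_distrib[symmetric] norm_mult of_real_diff[symmetric] mult_right_mono del: of_real_diff)
      next
        case False
        then show ?thesis using tame_zero[OF tame, of "snd p" "fst p"] by simp
      qed
    qed (use int H gc tame_integrable[OF tame] in \<open>auto intro!: integrable_norm Bochner_Integration.integrable_diff\<close>)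
    also have "\<dots> = e * N" by (simp add: N_def)
    finally show ?thesis .
  qed
  have "norm (LINT p|lborel. complex_of_real (H (cis (w * fst p), snd p)) * f p) \<le> 0 + e" if "e > 0" for e
  proof -
    have "e / (N + 1) * N \<le> e" using N0 that by (simp add: field_simps)
    then show ?thesis using small[of "e / (N + 1)"] N0 that by auto
  qed
  then have "norm (LINT p|lborel. complex_of_real (H (cis (w * fst p), snd p)) * f p) \<le> 0"
    by (rule field_le_epsilon)
  then show ?thesis by simp
qed

definition bump :: "real \<Rightarrow> real \<times> 'a::euclidean_space \<Rightarrow> real \<times> 'a \<Rightarrow> real" where
  "bump \<delta> p0 p = max 0 (\<delta> - \<bar>fst p - fst p0\<bar> - norm (snd p - snd p0))"

text \<open>As \<open>w \<rightarrow> 0\<close> the rescaled chord \<open>\<bar>cis (w t) - cis (w t0)\<bar> / w\<close> converges to \<open>\<bar>t - t0\<bar>\<close>. So a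
  bump around a point of space-time is a bounded pointwise limit of functions that are periodic
  in time, with periods growing to infinity, and dominated convergence removes the periodicity.\<close>

lemma annihilated_bump_integral:
  fixes f :: "real \<times> 'a::euclidean_space \<Rightarrow> complex"
  assumes f: "annihilated R f"
  shows "(LINT p|lborel. complex_of_real (bump \<delta> p0 p) * f p) = 0"
proof -
  have tame: "tame R f" using f by (simp add: annihilated_def)
  define w :: "nat \<Rightarrow> real" where "w n = inverse (real (Suc n))" for n
  define H where "H n q = max 0 (\<delta> - norm (fst q - cis (w n * fst p0)) / w n - norm (snd q - snd p0))"
    for n and q :: "complex \<times> 'a"
  have w0: "w n > 0" for n by (simp add: w_def)
  have Hc: "continuous_on UNIV (H n)" for n
    unfolding H_def using w0[of n] by (intro continuous_intros) auto
  have bc: "continuous_on UNIV (bump \<delta> p0)"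
    unfolding bump_def by (intro continuous_intros)
  have "(\<lambda>n. LINT p|lborel. complex_of_real (H n (cis (w n * fst p), snd p)) * f p) \<longlonglongrightarrow>
      (LINT p|lborel. complex_of_real (bump \<delta> p0 p) * f p)"
  proof (rule integral_dominated_convergence[where w = "\<lambda>p. \<bar>\<delta>\<bar> * norm (f p)"])
    show "(\<lambda>p. complex_of_real (bump \<delta> p0 p) * f p) \<in> borel_measurable lborel"
      using bc tame_continuous[OF tame] 
      by (simp, intro borel_measurable_continuous_onI continuous_intros)
    show "(\<lambda>p. complex_of_real (H n (cis (w n * fst p), snd p)) * f p) \<in> borel_measurable lborel" for n
      using tame_integrable[OF tame_mult_periodic[OF tame Hc]] by (rule borel_measurable_integrable)
    show "integrable lborel (\<lambda>p. \<bar>\<delta>\<bar> * norm (f p))"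
      using tame_integrable[OF tame] by auto
    show "AE p in lborel. norm (complex_of_real (H n (cis (w n * fst p), snd p)) * f p) \<le> \<bar>\<delta>\<bar> * norm (f p)" for n
    proof (intro AE_I2)
      fix p :: "real \<times> 'a"
      have "0 \<le> norm (cis (w n * fst p) - cis (w n * fst p0)) / w n"
        using w0[of n] by simp
      then have "\<bar>H n (cis (w n * fst p), snd p)\<bar> \<le> \<bar>\<delta>\<bar>"
        using norm_ge_zero[of "snd p - snd p0"] unfolding H_def fst_conv snd_conv by linarith
      then show "norm (complex_of_real (H n (cis (w n * fst p), snd p)) * f p) \<le> \<bar>\<delta>\<bar> * norm (f p)"
        by (simp add: norm_mult mult_right_mono)
    qed
    show "AE p in lborel. (\<lambda>n. complex_of_real (H n (cis (w n * fst p), snd p)) * f p) \<longlonglongrightarrow>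
        complex_of_real (bump \<delta> p0 p) * f p"
    proof (intro AE_I2)
      fix p :: "real \<times> 'a"
      define D where "D s = exp (\<i> * s * of_real (fst p)) - exp (\<i> * s * of_real (fst p0))" for s
      have "(D has_field_derivative \<i> * of_real (fst p - fst p0)) (at 0)"
        unfolding D_def by (auto intro!: derivative_eq_intros simp: algebra_simps)
      then have "((\<lambda>s. D s / s) \<longlongrightarrow> \<i> * of_real (fst p - fst p0)) (at 0)"
        by (simp add: DERIV_def D_def)
      moreover have "w \<longlonglongrightarrow> 0"
        unfolding w_def by (rule LIMSEQ_inverse_real_of_nat)
      then have "(\<lambda>n. complex_of_real (w n)) \<longlonglongrightarrow> of_real 0"
        by (rule tendsto_of_real)
      then have "filterlim (\<lambda>n. complex_of_real (w n)) (at 0) sequentially"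
        using w0 by (auto simp: filterlim_at less_imp_neq[symmetric] intro!: always_eventually)
      ultimately have "(\<lambda>n. D (of_real (w n)) / of_real (w n)) \<longlonglongrightarrow> \<i> * of_real (fst p - fst p0)"
        by (rule filterlim_compose)
      then have "(\<lambda>n. norm (D (of_real (w n)) / of_real (w n))) \<longlonglongrightarrow> norm (\<i> * complex_of_real (fst p - fst p0))"
        by (rule tendsto_norm)
      moreover have "norm (D (of_real (w n)) / of_real (w n)) = 
          norm (cis (w n * fst p) - cis (w n * fst p0)) / w n" for n
        using w0[of n] by (simp add: norm_divide D_def cis_conv_exp mult.assoc)
      moreover have "norm (\<i> * complex_of_real (fst p - fst p0)) = \<bar>fst p - fst p0\<bar>"
        unfolding norm_mult norm_of_real by simp
      ultimately have "(\<lambda>n. norm (cis (w n * fst p) - cis (w n * fst p0)) / w n) \<longlonglongrightarrow> \<bar>fst p - fst p0\<bar>"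
        by simp
      then show "(\<lambda>n. complex_of_real (H n (cis (w n * fst p), snd p)) * f p) \<longlonglongrightarrow>
          complex_of_real (bump \<delta> p0 p) * f p"
        unfolding H_def bump_def fst_conv snd_conv by (intro tendsto_intros)
    qed
  qed
  then have "(\<lambda>n. 0) \<longlonglongrightarrow> (LINT p|lborel. complex_of_real (bump \<delta> p0 p) * f p)"
    by (simp add: annihilated_periodic_integral[OF f Hc])
  then show ?thesis
    by (simp add: LIMSEQ_const_iff)
qed

text \<open>If \<open>f p0 \<noteq> 0\<close>, then the real part of \<open>cnj (f p0) f\<close> is bounded below by a positive number near
  \<open>p0\<close>, and the integral of \<open>f\<close> against a narrow bump at \<open>p0\<close> cannot be zero.\<close>

theorem fourier_laplace_injective:
  fixes f :: "real \<times> 'a::euclidean_space \<Rightarrow> complex"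
  assumes tame: "tame R f" and zero: "\<And>\<tau> \<theta>. fourier_laplace f \<tau> 1 \<theta> = 0"
  shows "f p0 = 0"
proof (rule ccontr)
  assume nz: "f p0 \<noteq> 0"
  define h where "h p = Re (cnj (f p0) * f p)" for p
  have hc: "continuous_on UNIV h"
    unfolding h_def using tame_continuous[OF tame] by (intro continuous_intros)
  define m where "m = h p0"
  have m: "m > 0"
    using nz by (simp add: m_def h_def complex_neq_0 power2_eq_square)
  obtain \<delta> where \<delta>: "\<delta> > 0" "\<And>p. dist p p0 < \<delta> \<Longrightarrow> dist (h p) (h p0) < m / 2"
    using hc m unfolding continuous_on_iff by (metis UNIV_I half_gt_zero)
  have lower: "m / 2 * (\<delta> / 2) * indicator (ball p0 (\<delta> / 4)) p \<le> bump \<delta> p0 p * h p" for p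
  proof -
    have fs: "\<bar>fst p - fst p0\<bar> \<le> dist p p0" "norm (snd p - snd p0) \<le> dist p p0"
      using dist_fst_le[of p p0] dist_snd_le[of p p0] by (simp_all add: dist_norm)
    show ?thesis
    proof (cases "bump \<delta> p0 p > 0")
      case True
      have "dist p p0 \<le> \<bar>fst p - fst p0\<bar> + norm (snd p - snd p0)"
        by (simp add: dist_norm norm_prod_def sqrt_sum_squares_le_sum_abs[of "fst p - fst p0" "norm (snd p - snd p0)", simplified])
      then have "dist p p0 < \<delta>" using True by (simp add: bump_def)
      then have h: "h p > m / 2" using \<delta>(2)[of p] unfolding m_def dist_real_def by linarith
      have "\<delta> / 2 * indicator (ball p0 (\<delta> / 4)) p \<le> bump \<delta> p0 p"
      proof (cases "dist p p0 < \<delta> / 4")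
        case True
        then have "\<delta> / 2 \<le> bump \<delta> p0 p" using fs unfolding bump_def by linarith
        then show ?thesis using True by (simp add: dist_commute)
      next
        case False
        then show ?thesis by (simp add: dist_commute bump_def)
      qed
      then have "(m / 2) * (\<delta> / 2 * indicator (ball p0 (\<delta> / 4)) p) \<le> h p * bump \<delta> p0 p"
      proof (rule mult_mono[OF less_imp_le[OF h]])
        show "0 \<le> h p" using h m by linarith
        show "0 \<le> \<delta> / 2 * indicator (ball p0 (\<delta> / 4)) p" using \<delta>(1) by simp
      qed
      then show ?thesis by (simp add: ac_simps)
    next
      case False
      then have "p \<notin> ball p0 (\<delta> / 4)"
        using fs \<delta>(1) unfolding bump_def mem_ball dist_commute[of p0] by linarith
      moreover have "bump \<delta> p0 p = 0" using False by (simp add: bump_def)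
      ultimately show ?thesis by simp
    qed
  qed
  have bt: "tame R (\<lambda>p. complex_of_real (bump \<delta> p0 p) * f p)"
  proof (rule tame_mult[OF tame])
    show "continuous_on UNIV (\<lambda>p. complex_of_real (bump \<delta> p0 p))"
      unfolding bump_def by (intro continuous_intros)
    show "norm (complex_of_real (bump \<delta> p0 (t, x))) \<le> \<delta>" for t x
      using \<delta>(1) by (auto simp: bump_def intro: order_trans[OF _ norm_ge_zero])
  qed
  have int: "integrable lborel (\<lambda>p. cnj (f p0) * (complex_of_real (bump \<delta> p0 p) * f p))"
    using tame_integrable[OF bt] by auto
  have Re_eq: "bump \<delta> p0 p * h p = Re (cnj (f p0) * (complex_of_real (bump \<delta> p0 p) * f p))" for p
    by (simp add: h_def algebra_simps)
  have "0 < m / 2 * (\<delta> / 2) * measure lborel (ball p0 (\<delta> / 4))"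
    using m \<delta>(1) content_ball_pos[of "\<delta> / 4" p0] by simp
  also have "\<dots> = (LINT p|lborel. m / 2 * (\<delta> / 2) * indicator (ball p0 (\<delta> / 4)) p)"
    by simp
  also have "\<dots> \<le> (LINT p|lborel. bump \<delta> p0 p * h p)"
  proof (rule integral_mono[OF _ _ lower])
    show "integrable lborel (\<lambda>p. m / 2 * (\<delta> / 2) * indicator (ball p0 (\<delta> / 4)) p)"
      using emeasure_bounded_finite[OF bounded_ball, of p0 "\<delta> / 4"]
      by (intro integrable_mult_right integrable_real_indicator) auto
    show "integrable lborel (\<lambda>p. bump \<delta> p0 p * h p)"
      unfolding Re_eq using int by (rule integrable_Re)
  qed
  also have "\<dots> = Re (LINT p|lborel. cnj (f p0) * (complex_of_real (bump \<delta> p0 p) * f p))"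
    unfolding Re_eq by (rule integral_Re[OF int])
  also have "\<dots> = 0"
    using annihilated_bump_integral[of R f \<delta> p0] tame zero by (simp add: annihilated_def)
  finally show False by simp
qed

section \<open>A vanishing light ray transform forces closedness\<close>

text \<open>The admissible unit vectors are \<open>(\<tau> / \<bar>\<eta>\<bar>\<^sup>2) \<eta> + r v\<close> and \<open>(\<tau> / \<bar>\<eta>\<bar>\<^sup>2) \<eta> - r v\<close>, where \<open>v\<close>
  is a unit vector orthogonal to \<open>\<eta>\<close> and \<open>r\<^sup>2 = 1 - \<tau>\<^sup>2 / \<bar>\<eta>\<bar>\<^sup>2\<close>; here \<open>r > 0\<close> because the
  frequency is space-like. The difference of the two equations shows that the linear form \<open>a\<close>
  vanishes on the orthogonal complement of \<open>\<eta>\<close>, and their sum gives its value on \<open>\<eta>\<close>. In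
  dimension one there is no \<open>v\<close>, and the conclusion fails.\<close>

lemma spacelike_covector_proportional:
  fixes a :: "'n::finite \<Rightarrow> complex" and \<eta> :: "real^'n"
  assumes dim: "CARD('n) \<ge> 2" and spacelike: "\<bar>\<tau>\<bar> < norm \<eta>"
    and zero: "\<And>\<omega>. norm \<omega> = 1 \<Longrightarrow> \<eta> \<bullet> \<omega> = \<tau> \<Longrightarrow> a0 + (\<Sum>j\<in>UNIV. of_real (\<omega> $ j) * a j) = 0"
  shows "of_real \<tau> * a j + of_real (\<eta> $ j) * a0 = 0"
proof -
  define L where "L v = (\<Sum>j\<in>UNIV. complex_of_real (v $ j) * a j)" for v :: "real^'n"
  have L_add: "L (v + w) = L v + L w" and L_scale: "L (r *\<^sub>R v) = of_real r * L v" for v w r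
    by (simp_all add: L_def algebra_simps sum.distrib sum_distrib_left)
  have pos: "norm \<eta> > 0" using spacelike by linarith
  define c where "c = \<tau> / (norm \<eta>)\<^sup>2"
  define r where "r = sqrt (1 - \<tau>\<^sup>2 / (norm \<eta>)\<^sup>2)"
  have "\<tau>\<^sup>2 < (norm \<eta>)\<^sup>2"
    using spacelike by (metis abs_le_square_iff abs_norm_cancel linorder_not_le)
  then have frac: "\<tau>\<^sup>2 / (norm \<eta>)\<^sup>2 < 1" using pos by simp
  then have r0: "r > 0" and r2: "r\<^sup>2 = 1 - \<tau>\<^sup>2 / (norm \<eta>)\<^sup>2" by (auto simp: r_def)
  have unit: "a0 + of_real c * L \<eta> + of_real k * L v = 0"
    if v: "norm v = 1" "\<eta> \<bullet> v = 0" and k: "k\<^sup>2 = r\<^sup>2" for v k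
  proof -
    have "(norm (c *\<^sub>R \<eta> + k *\<^sub>R v))\<^sup>2 = c\<^sup>2 * (\<eta> \<bullet> \<eta>) + k\<^sup>2 * (v \<bullet> v)"
      using v by (simp only: power2_norm_eq_inner)
        (simp add: inner_add_left inner_add_right inner_commute[of v \<eta>] power2_eq_square)
    also have "\<dots> = c\<^sup>2 * (norm \<eta>)\<^sup>2 + k\<^sup>2"
      using v by (simp add: power2_norm_eq_inner[symmetric])
    also have "\<dots> = 1"
      using pos unfolding k r2 by (simp add: c_def power2_eq_square field_simps)
    finally have "norm (c *\<^sub>R \<eta> + k *\<^sub>R v) = 1"
      by (simp add: power2_eq_1_iff) (smt (verit) norm_ge_zero)
    moreover have "\<eta> \<bullet> (c *\<^sub>R \<eta> + k *\<^sub>R v) = \<tau>"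
      using v pos by (simp add: inner_add_right c_def power2_norm_eq_inner[symmetric])
    ultimately have "a0 + L (c *\<^sub>R \<eta> + k *\<^sub>R v) = 0"
      unfolding L_def by (rule zero)
    then show ?thesis by (simp add: L_add L_scale add.assoc)
  qed
  have orth_unit: "L v = 0 \<and> a0 + of_real c * L \<eta> = 0" if v: "norm v = 1" "\<eta> \<bullet> v = 0" for v
  proof -
    have 1: "a0 + of_real c * L \<eta> + of_real r * L v = 0" 
      and 2: "a0 + of_real c * L \<eta> - of_real r * L v = 0"
      using unit[OF v, of r] unit[OF v, of "- r"] by simp_all
    have "2 * (of_real r * L v) = (a0 + of_real c * L \<eta> + of_real r * L v) - (a0 + of_real c * L \<eta> - of_real r * L v)"
      by simp
    also have "\<dots> = 0" unfolding 1 2 by simp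
    finally show ?thesis using r0 1 by simp
  qed
  have orth: "L v = 0" if v: "\<eta> \<bullet> v = 0" for v
  proof (cases "v = 0")
    case False
    then have "L (v /\<^sub>R norm v) = 0" using orth_unit[of "v /\<^sub>R norm v"] v by simp
    then show ?thesis using False by (simp only: L_scale) simp
  qed (simp add: L_def)
  obtain v :: "real^'n" where "v \<noteq> 0" "orthogonal \<eta> v"
    using orthogonal_to_vector_exists[of \<eta>] dim by auto
  then have a0: "a0 + of_real c * L \<eta> = 0"
    using orth_unit[of "v /\<^sub>R norm v"] by (simp add: orthogonal_def)
  define w where "w = axis j 1 + (- (\<eta> $ j / (norm \<eta>)\<^sup>2)) *\<^sub>R \<eta>"
  have "\<eta> \<bullet> w = 0"
    using pos by (simp add: w_def inner_diff_right inner_axis power2_norm_eq_inner[symmetric])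
  then have "L w = 0" by (rule orth)
  moreover have "L (axis j 1) = a j"
    by (simp add: L_def axis_def if_distrib[of complex_of_real] if_distrib[of "\<lambda>x. x * _"] sum.delta' cong: if_cong)
  ultimately have "a j = of_real (\<eta> $ j / (norm \<eta>)\<^sup>2) * L \<eta>"
    unfolding w_def L_add L_scale by (simp add: add_eq_0_iff)
  then have "of_real \<tau> * a j + of_real (\<eta> $ j) * a0 = of_real (\<eta> $ j) * (a0 + of_real c * L \<eta>)"
    by (simp add: c_def algebra_simps)
  then show ?thesis by (simp add: a0)
qed

text \<open>For a fixed direction \<open>\<theta> \<noteq> 0\<close> the relation between the transforms of \<open>A j\<close> and \<open>A0\<close> is an
  identity between entire functions of \<open>z\<close> that holds on a ray of the imaginary axis. At
  \<open>z = 1\<close> it says, after integration by parts, that the transform of the curl component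
  \<open>\<partial>\<^sub>t A\<^sub>j - \<partial>\<^sub>j A0\<close> is zero.\<close>

theorem light_ray_closed:
  fixes A0 :: "real \<times> (real^'n) \<Rightarrow> complex" and A :: "'n \<Rightarrow> real \<times> (real^'n) \<Rightarrow> complex"
  assumes dim: "CARD('n) \<ge> 2"
    and smooth: "smooth A0" "smooth (A j)"
    and tame: "tame R A0" "\<And>i. tame R (A i)" "tame R (partial_t A0)" "tame R (partial_x j A0)" "tame R (partial_t (A j))"
    and ray: "\<And>(\<omega> :: real^'n) y. norm \<omega> = 1 \<Longrightarrow>
      (LINT s|lborel. A0 (s, y + s *\<^sub>R \<omega>) + (\<Sum>i\<in>UNIV. of_real (\<omega> $ i) * A i (s, y + s *\<^sub>R \<omega>))) = 0"
  shows "partial_t (A j) p = partial_x j A0 p"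
proof -
  have ortho: "of_real \<tau> * fourier_laplace (A j) \<tau> (\<i> * of_real s) \<theta> + of_real (s * \<theta> $ j) * fourier_laplace A0 \<tau> (\<i> * of_real s) \<theta> = 0"
    if "\<bar>\<tau>\<bar> < norm (s *\<^sub>R \<theta>)" for \<tau> s and \<theta> :: "real^'n"
  proof -
    let ?z = "\<i> * of_real s"
    have "fourier_laplace A0 \<tau> ?z \<theta> + (\<Sum>i\<in>UNIV. of_real (\<omega> $ i) * fourier_laplace (A i) \<tau> ?z \<theta>) = 0"
      if \<omega>: "norm \<omega> = 1" "(s *\<^sub>R \<theta>) \<bullet> \<omega> = \<tau>" for \<omega>
    proof -
      have t1: "tame R (\<lambda>p. \<Sum>i\<in>UNIV. of_real (\<omega> $ i) * A i p)"
        by (intro tame_sum tame_cmult tame)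
      have "fourier_laplace (\<lambda>p. A0 p + (\<Sum>i\<in>UNIV. of_real (\<omega> $ i) * A i p)) \<tau> ?z \<theta> = 0"
        by (rule fourier_laplace_light_ray[OF tame_add[OF tame(1) t1], of \<omega>]) (use \<omega> ray in simp_all)
      then show ?thesis
        by (simp add: fourier_laplace_add[OF tame(1) t1] fourier_laplace_sum[where R = R] fourier_laplace_cmult tame_cmult tame)
    qed
    from spacelike_covector_proportional[OF dim that this] show ?thesis by simp
  qed
  \<comment> \<open>The factor \<open>s\<close> in the relation on the imaginary axis becomes \<open>- \<i> z\<close> for \<open>z = \<i> s\<close>.\<close>
  have nonzero: "of_real \<tau> * fourier_laplace (A j) \<tau> z \<theta> - \<i> * z * of_real (\<theta> $ j) * fourier_laplace A0 \<tau> z \<theta> = 0"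
    if "\<theta> \<noteq> 0" for \<tau> z and \<theta> :: "real^'n"
  proof (rule entire_eq_zero_of_imaginary_ray[where S = "\<bar>\<tau>\<bar> / norm \<theta>" and
        h = "\<lambda>z. of_real \<tau> * fourier_laplace (A j) \<tau> z \<theta> - \<i> * z * of_real (\<theta> $ j) * fourier_laplace A0 \<tau> z \<theta>"])
    show "(\<lambda>z. of_real \<tau> * fourier_laplace (A j) \<tau> z \<theta> - \<i> * z * of_real (\<theta> $ j) * fourier_laplace A0 \<tau> z \<theta>) holomorphic_on UNIV"
      by (intro holomorphic_intros fourier_laplace_entire[OF tame(1)] fourier_laplace_entire[OF tame(2)])
    fix s assume s: "s > \<bar>\<tau>\<bar> / norm \<theta>"
    then have "\<bar>\<tau>\<bar> < s * norm \<theta>" using that by (simp add: divide_less_eq)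
    moreover have "s > 0" using s by (rule le_less_trans[rotated]) simp
    ultimately have "\<bar>\<tau>\<bar> < norm (s *\<^sub>R \<theta>)" by simp
    from ortho[OF this] show "of_real \<tau> * fourier_laplace (A j) \<tau> (\<i> * of_real s) \<theta> - 
        \<i> * (\<i> * of_real s) * of_real (\<theta> $ j) * fourier_laplace A0 \<tau> (\<i> * of_real s) \<theta> = 0"
      by (simp add: algebra_simps)
  qed
  have all: "of_real \<tau> * fourier_laplace (A j) \<tau> 1 \<theta> - \<i> * of_real (\<theta> $ j) * fourier_laplace A0 \<tau> 1 \<theta> = 0"
    for \<tau> and \<theta> :: "real^'n"
  \<comment> \<open>For \<open>\<theta> = 0\<close> no frequency on the line is space-like; the value at the origin is instead
    read off at \<open>z = 0\<close> on a line with another direction.\<close>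
  proof (cases "\<theta> = 0")
    case True
    have "fourier_laplace f \<tau> 1 0 = fourier_laplace f \<tau> 0 (axis j 1)" for f :: "real \<times> (real^'n) \<Rightarrow> complex"
      by (simp add: fourier_laplace_def phase_def)
    then show ?thesis
      using True nonzero[of "axis j 1" \<tau> 0] by (simp add: axis_eq_0_iff)
  qed (use nonzero[of \<theta> \<tau> 1] in simp)
  define F where "F p = partial_t (A j) p - partial_x j A0 p" for p
  have "fourier_laplace F \<tau> 1 \<theta> = 0" for \<tau> \<theta>
  proof -
    have t: "fourier_laplace (partial_t f) \<tau> 1 \<theta> = \<i> * of_real \<tau> * fourier_laplace f \<tau> 1 \<theta>"
      if "smooth f" "tame R f" "tame R (partial_t f)" for f :: "real \<times> (real^'n) \<Rightarrow> complex"
      using fourier_laplace_derivative[OF that(2,3), of 0] smooth_line_derivative[OF that(1), of _ 0] by simp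
    have "fourier_laplace (\<lambda>p. partial_t A0 p + partial_x j A0 p) \<tau> 1 \<theta> = (\<i> * of_real \<tau> - of_real (\<theta> $ j)) * fourier_laplace A0 \<tau> 1 \<theta>"
    proof -
      have "(\<Sum>i\<in>UNIV. (axis j 1 $ i) *\<^sub>R partial_x i A0 q) = partial_x j A0 q" for q
        by (simp add: axis_def if_distrib[of "\<lambda>x. x *\<^sub>R _"] sum.delta' cong: if_cong)
      then show ?thesis
        using fourier_laplace_derivative[OF tame(1) tame_add[OF tame(3,4)], of "axis j 1"] 
          smooth_line_derivative[OF smooth(1), of _ "axis j 1"]
        by (simp add: inner_axis)
    qed
    then have "fourier_laplace (partial_x j A0) \<tau> 1 \<theta> = - of_real (\<theta> $ j) * fourier_laplace A0 \<tau> 1 \<theta>"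
      by (simp add: fourier_laplace_add[OF tame(3,4)] t smooth tame algebra_simps eq_neg_iff_add_eq_0)
    moreover have "fourier_laplace (partial_t (A j)) \<tau> 1 \<theta> = \<i> * of_real \<tau> * fourier_laplace (A j) \<tau> 1 \<theta>"
      by (intro t smooth tame)
    ultimately have "fourier_laplace F \<tau> 1 \<theta> = \<i> * (of_real \<tau> * fourier_laplace (A j) \<tau> 1 \<theta> - \<i> * of_real (\<theta> $ j) * fourier_laplace A0 \<tau> 1 \<theta>)"
      unfolding F_def fourier_laplace_diff[OF tame(5,4)] by (simp add: algebra_simps)
    then show ?thesis by (simp only: all mult_zero_right)
  qed
  moreover have "tame R F"
    unfolding F_def by (intro tame_diff tame)
  ultimately have "F p = 0" by (rule fourier_laplace_injective[where f = F and R = R, rotated])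
  then show ?thesis by (simp add: F_def)
qed

section \<open>Integrating from the infinite past\<close>

text \<open>Both tails of the time integral are treated at once: on \<open>S\<close> the rapidly decaying factor is at
  most \<open>(1 + T)\<close> to the power \<open>- M\<close>, and the remaining factor is integrable.\<close>

lemma rapid_tail_bound:
  fixes h :: "real \<Rightarrow> complex"
  assumes M: "M > 0" and cont: "continuous_on UNIV h"
    and bound: "\<And>s. norm (h s) \<le> C * (1 + \<bar>s\<bar>) powr (- M) * inverse (1 + s\<^sup>2)"
    and S: "S \<in> sets borel" "\<And>s. s \<in> S \<Longrightarrow> T \<le> \<bar>s\<bar>" and T: "T \<ge> 0"
  shows "norm (LINT s:S|lborel. h s) \<le> C * (LINT s|lborel. inverse (1 + s\<^sup>2)) * (1 + T) powr (- M)"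
proof -
  have C: "C \<ge> 0" using order_trans[OF norm_ge_zero bound[of 0]] by simp
  have dom: "norm (indicator S s *\<^sub>R h s) \<le> C * (1 + T) powr (- M) * inverse (1 + s\<^sup>2)" for s
  proof (cases "s \<in> S")
    case True
    have "(1 + \<bar>s\<bar>) powr (- M) \<le> (1 + T) powr (- M)"
      using S(2)[OF True] M T by (intro powr_mono2') auto
    then have "C * (1 + \<bar>s\<bar>) powr (- M) * inverse (1 + s\<^sup>2) \<le> C * (1 + T) powr (- M) * inverse (1 + s\<^sup>2)"
      using C by (intro mult_right_mono mult_left_mono) auto
    then show ?thesis using True bound[of s] by simp
  qed (use C in simp)
  have int: "integrable lborel (\<lambda>s. C * (1 + T) powr (- M) * inverse (1 + s\<^sup>2))"
    by (intro integrable_mult_right integrable_inverse_1_plus_square_real)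
  have meas: "(\<lambda>s. indicator S s *\<^sub>R h s) \<in> borel_measurable lborel"
    using borel_measurable_continuous_onI[OF cont] S(1) by simp
  have ih: "integrable lborel (\<lambda>s. indicator S s *\<^sub>R h s)"
    by (rule Bochner_Integration.integrable_bound[OF int meas])
       (use dom order_trans[OF _ abs_ge_self] in \<open>auto intro!: AE_I2 simp del: norm_scaleR\<close>)
  have "norm (LINT s:S|lborel. h s) \<le> (LINT s|lborel. norm (indicator S s *\<^sub>R h s))"
    unfolding set_lebesgue_integral_def by (rule integral_norm_bound)
  also have "\<dots> \<le> (LINT s|lborel. C * (1 + T) powr (- M) * inverse (1 + s\<^sup>2))"
    by (intro integral_mono integrable_norm ih int dom)
  also have "\<dots> = C * (LINT s|lborel. inverse (1 + s\<^sup>2)) * (1 + T) powr (- M)"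
    by simp
  finally show ?thesis .
qed

definition past_integral :: "(real \<Rightarrow> complex) \<Rightarrow> real \<Rightarrow> complex" where
  "past_integral h t = (LBINT s=-\<infinity>..ereal t. h s)"

lemma
  fixes h :: "real \<Rightarrow> complex"
  assumes cont: "continuous_on UNIV h" and int: "integrable lborel h"
  shows past_integral_has_derivative: "(past_integral h has_vector_derivative h t) (at t)"
    and past_integral_eq: "past_integral h t = (LINT s:{..<t}|lborel. h s)"
    and total_minus_past_integral: "(LINT s|lborel. h s) - past_integral h t = (LINT s:{t<..}|lborel. h s)"
proof -
  have ii: "interval_lebesgue_integrable lborel a b h" for a b
    using int unfolding interval_lebesgue_integrable_def set_integrable_def
    by (auto intro!: integrable_mult_indicator)
  have add: "past_integral h a + (LBINT s=a..b. h s) = past_integral h b" for a b :: real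
    unfolding past_integral_def by (rule interval_integral_sum[OF ii])
  show "past_integral h t = (LINT s:{..<t}|lborel. h s)"
  proof -
    have "einterval (- \<infinity>) (ereal t) = {..<t}" by (auto simp: einterval_def)
    then show ?thesis by (simp add: past_integral_def interval_lebesgue_integral_def)
  qed
  have "past_integral h t + (LBINT s=t..\<infinity>. h s) = (LBINT s=-\<infinity>..\<infinity>. h s)"
    unfolding past_integral_def by (rule interval_integral_sum[OF ii])
  moreover have "einterval (ereal t) \<infinity> = {t<..}" by (auto simp: einterval_def)
  ultimately show "(LINT s|lborel. h s) - past_integral h t = (LINT s:{t<..}|lborel. h s)"
    by (simp add: interval_lebesgue_integral_def set_lebesgue_integral_def algebra_simps)
  have "((\<lambda>u. LBINT s=ereal (t - 1)..u. h s) has_vector_derivative h t) (at t within {t - 1..t + 1})"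
    by (rule interval_integral_FTC2) (auto intro: continuous_on_subset[OF cont])
  then have "((\<lambda>u. past_integral h (t - 1) + (LBINT s=ereal (t - 1)..u. h s)) has_vector_derivative h t) (at t within {t - 1..t + 1})"
    by (auto intro!: derivative_eq_intros)
  moreover have "at t within {t - 1..t + 1} = at t"
    by (rule at_within_Icc_at) auto
  ultimately show "(past_integral h has_vector_derivative h t) (at t)"
    unfolding add by (simp add: eta_contract_eq)
qed

text \<open>For positive times the integral over the past is minus the integral over the future; this is
  where the vanishing of the total integral enters.\<close>

lemma past_integral_rapid_decay:
  fixes h :: "real \<Rightarrow> complex"
  assumes M: "M > 0" and cont: "continuous_on UNIV h" and total: "(LINT s|lborel. h s) = 0"
    and bound: "\<And>s. norm (h s) \<le> C * (1 + \<bar>s\<bar>) powr (- M) * inverse (1 + s\<^sup>2)"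
    and int: "integrable lborel h"
  shows "norm (past_integral h t) \<le> C * (LINT s|lborel. inverse (1 + s\<^sup>2)) * (1 + \<bar>t\<bar>) powr (- M)"
proof (cases "t \<le> 0")
  case True
  show ?thesis
    unfolding past_integral_eq[OF cont int]
    by (rule rapid_tail_bound[OF M cont bound]) (use True in auto)
next
  case False
  have eq: "- past_integral h t = (LINT s:{t<..}|lborel. h s)"
    using total_minus_past_integral[OF cont int, of t] by (simp add: total)
  have "norm (past_integral h t) = norm (- past_integral h t)" by simp
  also have "\<dots> \<le> C * (LINT s|lborel. inverse (1 + s\<^sup>2)) * (1 + \<bar>t\<bar>) powr (- M)"
    unfolding eq by (rule rapid_tail_bound[OF M cont bound]) (use False in auto)
  finally show ?thesis .
qed

text \<open>Two of the powers of \<open>1 + \<bar>t\<bar>\<close> are spent on making the bound integrable in time.\<close>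

lemma norm_le_decay_bound:
  fixes t M a C :: real
  assumes "(1 + \<bar>t\<bar>) powr (M + 2) * a \<le> C" "C \<ge> 0" "a \<ge> 0"
  shows "a \<le> C * (1 + \<bar>t\<bar>) powr (- M) * inverse (1 + t\<^sup>2)"
proof -
  have "(1 + t\<^sup>2) * (1 + \<bar>t\<bar>) powr M * a \<le> (1 + \<bar>t\<bar>) powr 2 * (1 + \<bar>t\<bar>) powr M * a"
    using assms(3) by (intro mult_right_mono) (auto simp: powr_numeral power2_eq_square algebra_simps)
  also have "\<dots> \<le> C"
    using assms(1) by (simp add: powr_add mult.commute mult.left_commute)
  finally have "(1 + t\<^sup>2) * (1 + \<bar>t\<bar>) powr M * a \<le> C" .
  moreover have "0 < (1 + t\<^sup>2) * (1 + \<bar>t\<bar>) powr M"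
    by (intro mult_pos_pos) (auto simp: add_pos_nonneg)
  ultimately have "a \<le> C / ((1 + t\<^sup>2) * (1 + \<bar>t\<bar>) powr M)"
    by (simp only: pos_le_divide_eq mult.commute[of a])
  then show ?thesis
    by (simp add: powr_minus divide_inverse mult.assoc mult.commute mult.left_commute)
qed

lemma
  fixes h :: "real \<Rightarrow> complex"
  assumes cont: "continuous_on UNIV h" 
    and bound: "\<And>s. norm (h s) \<le> C * (1 + \<bar>s\<bar>) powr (- 1) * inverse (1 + s\<^sup>2)"
    and int: "integrable lborel h"
  shows past_integral_tendsto_zero: "(past_integral h \<longlongrightarrow> 0) at_bot"
    and past_integral_tendsto_total: "(past_integral h \<longlongrightarrow> (LINT s|lborel. h s)) at_top"
proof -
  let ?K = "C * (LINT s|lborel. inverse (1 + s\<^sup>2))"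
  have lim: "((\<lambda>t. K * (1 + \<bar>t\<bar>) powr (- 1)) \<longlongrightarrow> 0) at_top" "((\<lambda>t. K * (1 + \<bar>t\<bar>) powr (- 1)) \<longlongrightarrow> 0) at_bot"
    for K :: real
    by real_asymp+
  have "\<forall>\<^sub>F t in at_bot. norm (past_integral h t) \<le> ?K * (1 + \<bar>t\<bar>) powr (- 1)"
    using eventually_le_at_bot[of 0]
  proof eventually_elim
    case (elim t)
    then show ?case
      unfolding past_integral_eq[OF cont int]
      by (intro rapid_tail_bound[OF _ cont bound]) auto
  qed
  then show "(past_integral h \<longlongrightarrow> 0) at_bot"
    by (rule Lim_null_comparison[OF _ lim(2)])
  have "\<forall>\<^sub>F t in at_top. norm ((LINT s|lborel. h s) - past_integral h t) \<le> ?K * (1 + \<bar>t\<bar>) powr (- 1)"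
    using eventually_ge_at_top[of 0]
  proof eventually_elim
    case (elim t)
    then show ?case
      unfolding total_minus_past_integral[OF cont int]
      by (intro rapid_tail_bound[OF _ cont bound]) auto
  qed
  then have "((\<lambda>t. (LINT s|lborel. h s) - past_integral h t) \<longlongrightarrow> 0) at_top"
    by (rule Lim_null_comparison[OF _ lim(1)])
  from tendsto_diff[OF tendsto_const this, of "LINT s|lborel. h s"]
  show "(past_integral h \<longlongrightarrow> (LINT s|lborel. h s)) at_top" by simp
qed

section \<open>The potential and its gradient\<close>

text \<open>By closedness, the two sides of the first equation have the same time derivative, namely the
  difference of \<open>A0\<close> between the end points of the segment. Since both sides tend to zero in the
  past, they are equal. The right-hand side also tends to zero in the future, so any
  limit of \<open>\<phi>\<close> in the future is independent of the point in space.\<close>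

lemma
  fixes A0 :: "real \<times> (real^'n) \<Rightarrow> complex" and A :: "'n \<Rightarrow> real \<times> (real^'n) \<Rightarrow> complex"
    and \<phi> :: "real \<times> (real^'n) \<Rightarrow> complex"
  assumes smooth: "smooth A0" "\<And>j. smooth (A j)"
    and tame: "\<And>j. tame R (A j)"
    and closed: "\<And>j p. partial_t (A j) p = partial_x j A0 p"
    and deriv: "\<And>t x. ((\<lambda>t. \<phi> (t, x)) has_vector_derivative A0 (t, x)) (at t)"
    and past: "\<And>x. ((\<lambda>t. \<phi> (t, x)) \<longlongrightarrow> 0) at_bot"
  shows potential_difference: "\<phi> (t, x + v) - \<phi> (t, x) = integral {0..1} (\<lambda>r. \<Sum>j\<in>UNIV. (v $ j) *\<^sub>R A j (t, x + r *\<^sub>R v))"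
    and potential_difference_future: "((\<lambda>t. \<phi> (t, x + v) - \<phi> (t, x)) \<longlongrightarrow> 0) at_top"
proof -
  define B where "B t r = (\<Sum>j\<in>UNIV. (v $ j) *\<^sub>R A j (t, x + r *\<^sub>R v))" for t r
  define B' where "B' t r = (\<Sum>j\<in>UNIV. (v $ j) *\<^sub>R partial_x j A0 (t, x + r *\<^sub>R v))" for t r
  note cont = smooth_continuous[OF smooth(1)] smooth_continuous[OF smooth(2)]
  have contB: "continuous_on S (B t)" for S t
    unfolding B_def
    by (intro continuous_intros continuous_on_compose2[OF cont(2)]) auto
  have contp: "continuous_on UNIV (partial_x j A0)" for j
    by (intro smooth_continuous smooth_partial smooth Basis_prod_components)
  have contB': "continuous_on S (\<lambda>(t, r). B' t r)" for S
    unfolding B'_def case_prod_beta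
    by (intro continuous_intros continuous_on_compose2[OF contp]) auto
  have dB: "((\<lambda>t. B t r) has_vector_derivative B' t r) (at t)" for t r
  proof -
    have "((\<lambda>t. A j (t, x + r *\<^sub>R v)) has_vector_derivative partial_x j A0 (t, x + r *\<^sub>R v)) (at t)" for j
      using smooth_line_derivative[OF smooth(2)[of j], where w = 0] by (simp add: closed)
    then show ?thesis
      unfolding B_def B'_def by (auto intro!: derivative_eq_intros)
  qed
  have "((\<lambda>r. A0 (t, x + r *\<^sub>R v)) has_vector_derivative B' t r) (at r)" for t r
    using has_vector_derivative_along_line[where p = "(t, x)" and t = r and v = "(0, v)", OF smooth_has_derivative[OF smooth(1)]]
    by (simp add: B'_def)
  then have "(B' t has_integral A0 (t, x + 1 *\<^sub>R v) - A0 (t, x + 0 *\<^sub>R v)) {0..1}" for t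
    by (intro fundamental_theorem_of_calculus) (auto intro: has_vector_derivative_at_within)
  then have intB': "integral {0..1} (B' t) = A0 (t, x + v) - A0 (t, x)" for t
    by (auto dest: integral_unique)
  define D where "D t = \<phi> (t, x + v) - \<phi> (t, x) - integral {0..1} (B t)" for t
  have "((\<lambda>t. integral (cbox 0 1) (B t)) has_vector_derivative integral (cbox 0 1) (B' t)) (at t within UNIV)" for t
  proof (rule leibniz_rule_vector_derivative)
    show "B t integrable_on cbox 0 1" for t
      by (rule integrable_continuous) (rule contB)
  qed (use dB contB' in auto)
  then have "(D has_vector_derivative A0 (t, x + v) - A0 (t, x) - (A0 (t, x + v) - A0 (t, x))) (at t)" for t
    unfolding D_def by (intro has_vector_derivative_diff deriv) (simp add: intB')
  then have "(D has_vector_derivative 0) (at t)" for t by simp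
  then have "\<exists>c. \<forall>t\<in>UNIV. D t = c"
    by (intro has_derivative_zero_constant) (simp_all add: has_vector_derivative_def)
  then obtain c where c: "\<And>t. D t = c" by auto
  obtain C where C: "\<And>t r. norm (B t r) \<le> C * inverse (1 + t\<^sup>2)"
  proof -
    obtain K where K: "\<And>j t x. norm (A j (t, x)) \<le> K j * inverse (1 + t\<^sup>2)"
      using tame_bound[OF tame] by metis
    have "norm (B t r) \<le> (\<Sum>j\<in>UNIV. \<bar>v $ j\<bar> * K j) * inverse (1 + t\<^sup>2)" for t r
    proof -
      have "norm (B t r) \<le> (\<Sum>j\<in>UNIV. \<bar>v $ j\<bar> * (K j * inverse (1 + t\<^sup>2)))"
        unfolding B_def by (rule sum_norm_le) (auto intro!: mult_left_mono K)
      then show ?thesis by (simp add: sum_distrib_right mult.assoc)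
    qed
    then show ?thesis using that by blast
  qed
  have intB: "norm (integral {0..1} (B t)) \<le> C * inverse (1 + t\<^sup>2)" for t
    using integral_bound[of 0 1 "B t" "C * inverse (1 + t\<^sup>2)"] contB C by simp
  have limB: "((\<lambda>t. integral {0..1} (B t)) \<longlongrightarrow> 0) at_bot" "((\<lambda>t. integral {0..1} (B t)) \<longlongrightarrow> 0) at_top"
    by (rule tendsto_zero_at_bot_of_bound[OF intB] tendsto_zero_at_top_of_bound[OF intB])+
  have "(D \<longlongrightarrow> 0 - 0 - 0) at_bot"
    unfolding D_def by (intro tendsto_diff past limB)
  then have "c = 0"
    unfolding c by (simp add: tendsto_const_iff)
  then have eq: "\<phi> (t, x + v) - \<phi> (t, x) = integral {0..1} (B t)" for t
    using c[of t] by (simp add: D_def)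
  from eq show "\<phi> (t, x + v) - \<phi> (t, x) = integral {0..1} (\<lambda>r. \<Sum>j\<in>UNIV. (v $ j) *\<^sub>R A j (t, x + r *\<^sub>R v))"
    by (simp add: B_def[abs_def])
  show "((\<lambda>t. \<phi> (t, x + v) - \<phi> (t, x)) \<longlongrightarrow> 0) at_top"
    unfolding eq by (rule limB)
qed

lemma gradient_of_averaged_difference:
  fixes g :: "real^'n \<Rightarrow> complex" and a :: "'n \<Rightarrow> real^'n \<Rightarrow> complex"
  assumes diff: "\<And>v. g (x + v) - g x = integral {0..1} (\<lambda>r. \<Sum>j\<in>UNIV. (v $ j) *\<^sub>R a j (x + r *\<^sub>R v))"
    and cont: "\<And>j. continuous_on UNIV (a j)"
  shows "(g has_derivative (\<lambda>v. \<Sum>j\<in>UNIV. (v $ j) *\<^sub>R a j x)) (at x)"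
  unfolding has_derivative_at_alt
proof (intro conjI allI impI)
  show "bounded_linear (\<lambda>v. \<Sum>j\<in>UNIV. (v $ j) *\<^sub>R a j x)"
    by (intro bounded_linear_sum bounded_linear_scaleR_const bounded_linear_vec_nth)
  fix e :: real assume e: "e > 0"
  define e' where "e' = e / CARD('n)"
  have e': "e' > 0" using e by (simp add: e'_def)
  have "\<exists>d>0. \<forall>y. dist y x < d \<longrightarrow> dist (a j y) (a j x) < e'" for j
    using cont[of j] e' unfolding continuous_on_iff by simp
  then obtain d where d: "\<And>j. d j > 0" "\<And>j y. dist y x < d j \<Longrightarrow> dist (a j y) (a j x) < e'"
    by metis
  define \<delta> where "\<delta> = Min (range d)"
  have \<delta>: "\<delta> > 0" "\<And>j. \<delta> \<le> d j" using d(1) by (auto simp: \<delta>_def)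
  show "\<exists>\<delta>>0. \<forall>y. norm (y - x) < \<delta> \<longrightarrow>
     norm (g y - g x - (\<Sum>j\<in>UNIV. ((y - x) $ j) *\<^sub>R a j x)) \<le> e * norm (y - x)"
  proof (intro exI[of _ \<delta>] conjI \<delta> allI impI)
    fix y assume y: "norm (y - x) < \<delta>"
    define v where "v = y - x"
    have ci: "continuous_on {0..1} (\<lambda>r. \<Sum>j\<in>UNIV. (v $ j) *\<^sub>R a j (x + r *\<^sub>R v))"
      by (intro continuous_intros continuous_on_compose2[OF cont]) auto
    have "g y - g x - (\<Sum>j\<in>UNIV. (v $ j) *\<^sub>R a j x) =
        integral {0..1} (\<lambda>r. \<Sum>j\<in>UNIV. (v $ j) *\<^sub>R a j (x + r *\<^sub>R v)) - 
        integral {0..1} (\<lambda>r::real. \<Sum>j\<in>UNIV. (v $ j) *\<^sub>R a j x)"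
      using diff[of v] by (simp add: v_def)
    also have "\<dots> = integral {0..1} (\<lambda>r. (\<Sum>j\<in>UNIV. (v $ j) *\<^sub>R a j (x + r *\<^sub>R v)) - (\<Sum>j\<in>UNIV. (v $ j) *\<^sub>R a j x))"
      by (intro Henstock_Kurzweil_Integration.integral_diff[symmetric] integrable_continuous_real ci continuous_intros)
    also have "norm \<dots> \<le> e * norm v * (1 - 0)"
    proof (rule integral_bound)
      show "continuous_on {0..1} (\<lambda>r. (\<Sum>j\<in>UNIV. (v $ j) *\<^sub>R a j (x + r *\<^sub>R v)) - (\<Sum>j\<in>UNIV. (v $ j) *\<^sub>R a j x))"
        by (intro continuous_intros ci)
      fix r :: real assume r: "r \<in> {0..1}"
      have "norm (r *\<^sub>R v) \<le> norm v" using r by (simp add: mult_left_le_one_le)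
      then have "dist (x + r *\<^sub>R v) x < d j" for j
        using y \<delta>(2)[of j] by (simp add: v_def dist_norm)
      then have close: "norm (a j (x + r *\<^sub>R v) - a j x) \<le> e'" for j
        using d(2)[of "x + r *\<^sub>R v" j] by (simp add: dist_norm less_imp_le)
      have "norm (\<Sum>j\<in>UNIV. (v $ j) *\<^sub>R (a j (x + r *\<^sub>R v) - a j x)) \<le> (\<Sum>j\<in>(UNIV::'n set). norm v * e')"
        by (rule sum_norm_le) (auto intro!: mult_mono close component_le_norm_cart)
      also have "\<dots> = e * norm v" by (simp add: e'_def)
      finally show "norm ((\<Sum>j\<in>UNIV. (v $ j) *\<^sub>R a j (x + r *\<^sub>R v)) - (\<Sum>j\<in>UNIV. (v $ j) *\<^sub>R a j x)) \<le> e * norm v"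
        by (simp add: sum_subtractf scaleR_diff_right)
    qed simp
    finally show "norm (g y - g x - (\<Sum>j\<in>UNIV. ((y - x) $ j) *\<^sub>R a j x)) \<le> e * norm (y - x)"
      by (simp add: v_def)
  qed
qed

text \<open>Joint continuity of the spatial gradient is what turns separate differentiability in \<open>t\<close> and
  in \<open>x\<close> into Frechet differentiability in \<open>(t, x)\<close>.\<close>

lemma has_derivative_from_components:
  fixes \<phi> A0 :: "real \<times> (real^'n) \<Rightarrow> complex" and A :: "'n \<Rightarrow> real \<times> (real^'n) \<Rightarrow> complex"
  assumes t: "((\<lambda>t. \<phi> (t, x)) has_vector_derivative A0 (t, x)) (at t)"
    and x: "\<And>t x. ((\<lambda>x. \<phi> (t, x)) has_derivative (\<lambda>v. \<Sum>j\<in>UNIV. (v $ j) *\<^sub>R A j (t, x))) (at x)"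
    and cont: "\<And>j. continuous_on UNIV (A j)"
  shows "(\<phi> has_derivative (\<lambda>(h, v). h *\<^sub>R A0 (t, x) + (\<Sum>j\<in>UNIV. (v $ j) *\<^sub>R A j (t, x)))) (at (t, x))"
proof -
  define fy where "fy t x = (\<Sum>j\<in>UNIV. blinfun_scaleR_left (A j (t, x)) o\<^sub>L blinfun_inner_left (axis j 1 :: real^'n))" for t x
  have apply_fy: "blinfun_apply (fy t x) = (\<lambda>v. \<Sum>j\<in>UNIV. (v $ j) *\<^sub>R A j (t, x))" for t x
    by (simp add: fy_def blinfun.sum_left fun_eq_iff inner_axis)
  have "continuous_on UNIV (\<lambda>p. fy (fst p) (snd p))"
    unfolding fy_def
    by (intro continuous_intros bounded_linear.continuous_on[OF bounded_linear_blinfun_scaleR_left]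
       continuous_on_compose2[OF cont]) auto
  then have "continuous (at (t, x)) (\<lambda>(t, x). fy t x)"
    by (simp add: continuous_on_eq_continuous_at case_prod_beta')
  then have "((\<lambda>(t, x). \<phi> (t, x)) has_derivative (\<lambda>(h, v). h *\<^sub>R A0 (t, x) + blinfun_apply (fy t x) v)) (at (t, x) within UNIV \<times> UNIV)"
    using t x by (intro has_derivative_partialsI) (auto simp: apply_fy has_vector_derivative_def)
  then show ?thesis by (simp add: apply_fy)
qed

lemma smooth_of_gradient:
  assumes "\<And>p. f differentiable (at p)" and "\<And>b. b \<in> Basis \<Longrightarrow> smooth (partial b f)"
  shows "smooth f"
proof -
  have "Ck k f" for k
  proof (cases k)
    case 0
    have "continuous_on UNIV f"
      using assms(1) by (auto simp: continuous_on_eq_continuous_at intro: differentiable_imp_continuous_within)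
    then show ?thesis using 0 by simp
  qed (use assms in \<open>auto simp: smooth_def\<close>)
  then show ?thesis by (simp add: smooth_def)
qed

section \<open>Gauge potentials with vanishing light ray transform\<close>

theorem theorem6p2:
  fixes A0 :: "real \<times> (real^'n) \<Rightarrow> complex"
    and A :: "'n \<Rightarrow> real \<times> (real^'n) \<Rightarrow> complex"
    and R :: real
  assumes dim: "CARD('n) \<ge> 2"
    and R: "R > 0"
    and smooth_A: "smooth A0" "\<And>j. smooth (A j)"
    and decay: "\<And>(M::real) \<alpha> \<beta>. M > 0 \<Longrightarrow>
      \<exists>C>0. \<forall>t x.
        (1 + \<bar>t\<bar>) powr M * norm (multi_partial \<alpha> \<beta> A0 (t, x)) \<le> C \<and>
        (\<forall>j. (1 + \<bar>t\<bar>) powr M * norm (multi_partial \<alpha> \<beta> (A j) (t, x)) \<le> C)"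
    and vanish: "\<And>t x. norm x \<ge> R \<Longrightarrow> A0 (t, x) = 0 \<and> (\<forall>j. A j (t, x) = 0)"
    and light_ray: "\<And>t (x :: real^'n) (\<omega> :: real^'n). \<omega> \<in> sphere 0 1 \<Longrightarrow>
      (LINT s|lborel. A0 (t + s, x + s *\<^sub>R \<omega>) +
        (\<Sum>j\<in>UNIV. complex_of_real (\<omega> $ j) * A j (t + s, x + s *\<^sub>R \<omega>))) = 0"
  shows "\<exists>\<phi> :: real \<times> (real^'n) \<Rightarrow> complex.
    smooth \<phi> \<and>
    A0 = partial_t \<phi> \<and> (\<forall>j. A j = partial_x j \<phi>) \<and>
    closure {p. \<phi> p \<noteq> 0} \<subseteq> UNIV \<times> {x. norm x \<le> R} \<and>
    (\<forall>(M::real) \<alpha> \<beta>. M > 0 \<longrightarrow>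
      (\<exists>C. \<forall>t x. (1 + \<bar>t\<bar>) powr M * norm (multi_partial \<alpha> \<beta> \<phi> (t, x)) \<le> C))"
proof -
  have cont: "continuous_on UNIV A0" "\<And>j. continuous_on UNIV (A j)"
    using smooth_A by (simp_all add: smooth_continuous)
  have zero: "A0 (t, x) = 0" "A j (t, x) = 0" if "norm x \<ge> R" for t x j
    using vanish[OF that] by auto
  have decay0: "\<exists>C\<ge>0. \<forall>t x. (1 + \<bar>t\<bar>) powr M * norm (multi_partial \<alpha> \<beta> A0 (t, x)) \<le> C"
    and decayA: "\<exists>C\<ge>0. \<forall>t x. (1 + \<bar>t\<bar>) powr M * norm (multi_partial \<alpha> \<beta> (A j) (t, x)) \<le> C"
    if "M > 0" for M \<alpha> \<beta> j
    using decay[OF that, of \<alpha> \<beta>] by (meson less_imp_le)+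
  have multi_simps: "multi_partial 0 (\<lambda>_. 0) f = f" "multi_partial 1 (\<lambda>_. 0) f = partial_t f"
    for f :: "real \<times> (real^'n) \<Rightarrow> complex"
    by (simp_all add: multi_partial_no_space)
  have tame: "tame R A0" "\<And>i. tame R (A i)" "tame R (partial_t A0)"
     "\<And>j. tame R (partial_x j A0)" "\<And>j. tame R (partial_t (A j))"
  proof -
    have two: "(2::real) > 0" by simp
    note partial_cont = smooth_continuous[OF smooth_partial[OF _ Basis_prod_components(1)]]
      smooth_continuous[OF smooth_partial[OF _ Basis_prod_components(2)]]
    show "tame R A0"
      using decay0[OF two, of 0 "\<lambda>_. 0"] unfolding multi_simps
      by (intro tame_of_decay cont(1)) (simp_all add: zero)
    show "tame R (A i)" for i
      using decayA[OF two, of 0 "\<lambda>_. 0" i] unfolding multi_simps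
      by (intro tame_of_decay cont(2)) (simp_all add: zero)
    show "tame R (partial_t A0)"
      using decay0[OF two, of 1 "\<lambda>_. 0"] unfolding multi_simps
      by (intro tame_of_decay partial_cont smooth_A) (simp_all add: zero partial_zero_outside[of R])
    show "tame R (partial_x j A0)" for j
      using decay0[OF two, of 0 "(\<lambda>_. 0)(j := 1)"] unfolding multi_partial_single
      by (intro tame_of_decay partial_cont smooth_A) (simp_all add: zero partial_zero_outside[of R])
    show "tame R (partial_t (A j))" for j
      using decayA[OF two, of 1 "\<lambda>_. 0" j] unfolding multi_simps
      by (intro tame_of_decay partial_cont smooth_A) (simp_all add: zero partial_zero_outside[of R])
  qed
  have ray: "(LINT s|lborel. A0 (s, y + s *\<^sub>R \<omega>) + (\<Sum>i\<in>UNIV. of_real (\<omega> $ i) * A i (s, y + s *\<^sub>R \<omega>))) = 0"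
    if "norm \<omega> = 1" for \<omega> y
    using light_ray[of \<omega> 0 y] that by simp
  have closed: "partial_t (A j) p = partial_x j A0 p" for j p
    by (rule light_ray_closed[OF dim smooth_A(1) smooth_A(2)[of j] tame(1,2,3) tame(4)[of j] tame(5)[of j] ray])

  define \<phi> where "\<phi> p = past_integral (\<lambda>s. A0 (s, snd p)) (fst p)" for p :: "real \<times> (real^'n)"
  have slice_cont: "continuous_on UNIV (\<lambda>s. A0 (s, x))" for x
    by (intro continuous_on_compose2[OF cont(1)] continuous_intros) auto
  have slice_int: "integrable lborel (\<lambda>s. A0 (s, x))" for x
  proof -
    obtain C where "\<And>t x. norm (A0 (t, x)) \<le> C * inverse (1 + t\<^sup>2)"
      using tame_bound[OF tame(1)] by blast
    then show ?thesis by (intro integrable_of_bound slice_cont)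
  qed
  have slice_bound: "\<exists>C\<ge>0. \<forall>s x. norm (A0 (s, x)) \<le> C * (1 + \<bar>s\<bar>) powr (- M) * inverse (1 + s\<^sup>2)"
    if "M > 0" for M
  proof -
    have "M + 2 > 0" using that by simp
    from decay0[OF this, of 0 "\<lambda>_. 0"] obtain C where 
      "C \<ge> 0" "\<And>t x. (1 + \<bar>t\<bar>) powr (M + 2) * norm (A0 (t, x)) \<le> C"
      unfolding multi_simps by blast
    then show ?thesis by (intro exI[of _ C]) (auto intro!: norm_le_decay_bound)
  qed
  obtain C1 where C1: "\<And>s x. norm (A0 (s, x)) \<le> C1 * (1 + \<bar>s\<bar>) powr (- 1) * inverse (1 + s\<^sup>2)"
    using slice_bound[of 1] by auto
  have \<phi>_t: "((\<lambda>t. \<phi> (t, x)) has_vector_derivative A0 (t, x)) (at t)" for t x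
    using past_integral_has_derivative[OF slice_cont slice_int] by (simp add: \<phi>_def)
  have \<phi>_past: "((\<lambda>t. \<phi> (t, x)) \<longlongrightarrow> 0) at_bot" 
    and \<phi>_future: "((\<lambda>t. \<phi> (t, x)) \<longlongrightarrow> (LINT s|lborel. A0 (s, x))) at_top" for x
    using past_integral_tendsto_zero[OF slice_cont C1 slice_int]
      past_integral_tendsto_total[OF slice_cont C1 slice_int] by (simp_all add: \<phi>_def)
  note diff = potential_difference[where \<phi> = \<phi>, OF smooth_A tame(2) closed \<phi>_t \<phi>_past]
    and diff_future = potential_difference_future[where \<phi> = \<phi>, OF smooth_A tame(2) closed \<phi>_t \<phi>_past]
  have total: "(LINT s|lborel. A0 (s, x)) = 0" for x
  proof -
    \<comment> \<open>At \<open>y\<close>, on the boundary of the ball, the total integral is zero because \<open>A0\<close> vanishes there;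
      the future limit of \<open>\<phi>\<close> is the same at \<open>x\<close> and at \<open>y\<close>.\<close>
    obtain y :: "real^'n" where y: "norm y = R"
      using R by (metis less_imp_le vector_choose_size)
    have "((\<lambda>t. \<phi> (t, x + (y - x)) - \<phi> (t, x)) \<longlongrightarrow> 
        (LINT s|lborel. A0 (s, x + (y - x))) - (LINT s|lborel. A0 (s, x))) at_top"
      by (intro tendsto_diff \<phi>_future)
    with diff_future[of x "y - x"] have "(LINT s|lborel. A0 (s, x + (y - x))) - (LINT s|lborel. A0 (s, x)) = 0"
      by (rule tendsto_unique[OF trivial_limit_at_top_linorder, rotated])
    then show ?thesis using zero(1)[of y] y by simp
  qed

  have \<phi>_x: "((\<lambda>x. \<phi> (t, x)) has_derivative (\<lambda>v. \<Sum>j\<in>UNIV. (v $ j) *\<^sub>R A j (t, x))) (at x)" for t x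
  proof (rule gradient_of_averaged_difference[where a = "\<lambda>j x. A j (t, x)"])
    show "continuous_on UNIV (\<lambda>x. A j (t, x))" for j
      by (intro continuous_on_compose2[OF cont(2)] continuous_intros) auto
  qed (rule diff)
  have \<phi>_deriv: "(\<phi> has_derivative (\<lambda>(h, v). h *\<^sub>R A0 p + (\<Sum>j\<in>UNIV. (v $ j) *\<^sub>R A j p))) (at p)" for p
    using has_derivative_from_components[where \<phi> = \<phi> and ?A0.0 = A0 and A = A, OF \<phi>_t \<phi>_x cont(2)] by (cases p) auto
  have \<phi>_partial_t: "partial_t \<phi> = A0"
    by (rule ext) (simp add: partial_eq[OF \<phi>_deriv])
  have \<phi>_partial_x: "partial_x j \<phi> = A j" for j
    by (rule ext) (simp add: partial_eq[OF \<phi>_deriv] axis_def if_distrib[of "\<lambda>x. x *\<^sub>R _"] sum.delta' cong: if_cong)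
  have "smooth \<phi>"
  proof (rule smooth_of_gradient)
    show "\<phi> differentiable (at p)" for p
      using \<phi>_deriv unfolding differentiable_def by blast
    fix b :: "real \<times> (real^'n)" assume "b \<in> Basis"
    then consider "b = (1, 0)" | j where "b = (0, axis j 1)"
      by (auto simp: Basis_prod_def Basis_vec_def)
    then show "smooth (partial b \<phi>)"
      by cases (simp_all add: \<phi>_partial_t \<phi>_partial_x smooth_A)
  qed
  moreover have "closure {p. \<phi> p \<noteq> 0} \<subseteq> UNIV \<times> {x. norm x \<le> R}"
  proof (rule closure_minimal)
    have "\<phi> (t, x) = 0" if "norm x > R" for t x
      using that zero(1)[of x] by (simp add: \<phi>_def past_integral_def)
    then show "{p. \<phi> p \<noteq> 0} \<subseteq> UNIV \<times> {x. norm x \<le> R}"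
      by (auto simp: not_less[symmetric])
    show "closed (UNIV \<times> {x :: real^'n. norm x \<le> R} :: (real \<times> (real^'n)) set)"
      by (intro closed_Times closed_UNIV closed_Collect_le continuous_intros)
  qed
  moreover have "\<exists>C. \<forall>t x. (1 + \<bar>t\<bar>) powr M * norm (multi_partial \<alpha> \<beta> \<phi> (t, x)) \<le> C"
    if M: "M > 0" for M :: real and \<alpha> \<beta>
  \<comment> \<open>If at least one derivative is taken, the innermost one turns \<open>\<phi>\<close> into a component of the
    given potential; only \<open>\<phi>\<close> itself has to be estimated.\<close>
  proof (cases "\<beta> = (\<lambda>_. 0)")
    case False
    then obtain j where "multi_partial \<alpha> \<beta> \<phi> = multi_partial \<alpha> (\<beta>(j := \<beta> j - 1)) (A j)"
      using multi_partial_decrease_space[OF False, of \<alpha> \<phi>] by (auto simp: \<phi>_partial_x)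
    then show ?thesis
      using decayA[OF M, of \<alpha> "\<beta>(j := \<beta> j - 1)" j] by auto
  next
    case \<beta>: True
    show ?thesis
    proof (cases \<alpha>)
      case (Suc m)
      have "multi_partial \<alpha> \<beta> \<phi> = multi_partial m \<beta> A0"
        unfolding \<beta> Suc multi_partial_no_space funpow_Suc_right by (simp add: \<phi>_partial_t)
      then show ?thesis
        using decay0[OF M, of m \<beta>] by auto
    next
      case 0
      obtain C where C: "\<And>s x. norm (A0 (s, x)) \<le> C * (1 + \<bar>s\<bar>) powr (- M) * inverse (1 + s\<^sup>2)"
        using slice_bound[OF M] by auto
      let ?K = "C * (LINT s|lborel. inverse (1 + s\<^sup>2))"
      have "(1 + \<bar>t\<bar>) powr M * norm (\<phi> (t, x)) \<le> ?K" for t x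
      proof -
        have "norm (\<phi> (t, x)) \<le> ?K * (1 + \<bar>t\<bar>) powr (- M)"
          unfolding \<phi>_def fst_conv snd_conv
          by (rule past_integral_rapid_decay[OF M slice_cont total C slice_int])
        then have "(1 + \<bar>t\<bar>) powr M * norm (\<phi> (t, x)) \<le> (1 + \<bar>t\<bar>) powr M * (?K * (1 + \<bar>t\<bar>) powr (- M))"
          by (intro mult_left_mono) auto
        also have "\<dots> = ?K"
          by (simp add: powr_minus)
        finally show ?thesis .
      qed
      then show ?thesis
        unfolding \<beta> 0 multi_simps by blast
    qed
  qed
  ultimately show ?thesis
    using \<phi>_partial_t \<phi>_partial_x by (intro exI[of _ \<phi>]) auto
qed

end
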